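(* Let $\mathbb{K}$ be a commutative ring, let $A = \bigoplus_{i \leq 0} A^i$ be a nonpositive central DG $\mathbb{K}$-ring (possibly noncommutative), and let $\bar{A} := \operatorname{H}^0(A)$. Let $i_0$ and $j_0$ be integers, let $M \in \mathsf{C}^{\leq i_0}(A^{\mathrm{op}})$ be a right DG $A$-module concentrated in degrees $\leq i_0$, and let $N \in \mathsf{C}^{\leq j_0}(A)$ be a left DG $A$-module concentrated in degrees $\leq j_0$. Then there is a unique isomorphism of $\mathbb{K}$-modules $$\theta_{M,N} : \operatorname{H}^{i_0}(M) \otimes_{\bar{A}} \operatorname{H}^{j_0}(N) \xrightarrow{\ \simeq\ } \operatorname{H}^{i_0+j_0}(M \otimes_A N)$$ such that $\theta_{M,N}([m] \otimes [n]) = [m \otimes n]$ for all $m \in M^{i_0}$ and $n \in N^{j_0}$. The isomorphism $\theta_{M,N}$ is functorial in $M$ and $N$.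
   Context: Gradings are by $\mathbb{Z}$ and cohomological (differentials have degree $+1$). A central DG $\mathbb{K}$-ring is a unital associative DG ring $A$ together with a ring homomorphism from $\mathbb{K}$ to the degree $0$ part of the center of $A$, with image consisting of cocycles; so $A$ is a DG $\mathbb{K}$-algebra in the traditional sense, and it need not be commutative. It is nonpositive if $A^i = 0$ for all $i > 0$. The ring $\bar{A} = \operatorname{H}^0(A)$ is a central $\mathbb{K}$-ring, and there is a canonical DG $\mathbb{K}$-ring homomorphism $A \to \bar{A}$. The cohomologies $\operatorname{H}^i$ of a left (resp. right) DG $A$-module are left (resp. right) $\bar{A}$-modules. $\mathsf{C}(A)$ is the DG category of left DG $A$-modules; right DG $A$-modules are treated as left DG modules over the opposite DG ring $A^{\mathrm{op}}$. For an integer $k$, $\mathsf{C}^{\leq k}(A)$ denotes the DG $A$-modules $N$ concentrated in degrees $\leq k$, i.e. $N = \bigoplus_{i \leq k} N^i$ (the underlying module, not just the cohomology); similarly for $A^{\mathrm{op}}$. Functoriality is with respect to strict homomorphisms of DG modules, namely degree $0$ homomorphisms that commute with the differentials. The tensor product $M \otimes_A N$ is the DG $\mathbb{K}$-module which is the quotient of $M \otimes_{\mathbb{K}} N$ by the relations $(m \cdot a) \otimes n = m \otimes (a \cdot n)$, with differential $\mathrm{d}(m \otimes n) = \mathrm{d}(m) \otimes n + (-1)^{i}\, m \otimes \mathrm{d}(n)$ for $m \in M^i$. It is concentrated in degrees $\leq i_0 + j_0$ when $M \in \mathsf{C}^{\leq i_0}(A^{\mathrm{op}})$ and $N \in \mathsf{C}^{\leq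 j_0}(A)$. For $N \in \mathsf{C}^{\leq j_0}(A)$ all elements $n \in N^{j_0}$ are cocycles, and $[n]$ denotes the cohomology class of $n$ in $\operatorname{H}^{j_0}(N)$; similarly for $m \in M^{i_0}$ and for elements of degree $i_0 + j_0$ of $M \otimes_A N$. *)

theory Defs
  imports "HOL-Algebra.Module" "HOL-Algebra.QuotRing" "HOL-Algebra.Free_Abelian_Groups"
begin

section \<open>Graded abelian groups and complexes\<close>

text \<open>
  All gradings are internal: the ambient abelian group is the direct sum of the pieces
  \<open>gr M i\<close>, for \<open>i\<close> an integer. As in the library's record \<^type>\<open>module\<close>, the
  fields \<open>mult\<close> and \<open>one\<close> carry no meaning unless the structure is a ring.
\<close>

record 'm dg = "'m ring" +
  gr :: "int \<Rightarrow> 'm set"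
  diff :: "'m \<Rightarrow> 'm"

definition homog_decomp :: "('m, 'x) dg_scheme \<Rightarrow> 'm \<Rightarrow> (int \<Rightarrow> 'm) \<Rightarrow> bool" where
  "homog_decomp M x f \<longleftrightarrow>
     (\<forall>i. f i \<in> gr M i) \<and> finite {i. f i \<noteq> \<zero>\<^bsub>M\<^esub>} \<and>
     x = (\<Oplus>\<^bsub>M\<^esub>i\<in>{i. f i \<noteq> \<zero>\<^bsub>M\<^esub>}. f i)"

definition homog_part :: "('m, 'x) dg_scheme \<Rightarrow> 'm \<Rightarrow> int \<Rightarrow> 'm" where
  "homog_part M x = (THE f. homog_decomp M x f)"

definition sgn_mult :: "('m, 'x) ring_scheme \<Rightarrow> int \<Rightarrow> 'm \<Rightarrow> 'm" where
  "sgn_mult M i x = (if even i then x else \<ominus>\<^bsub>M\<^esub> x)"  \<comment> \<open>\<open>(-1)^i x\<close>\<close>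

text \<open>The additive endomorphism acting on degree \<open>i\<close> as \<open>(-1)^i\<close>.\<close>

definition sgn_twist :: "('m, 'x) dg_scheme \<Rightarrow> 'm \<Rightarrow> 'm" where
  "sgn_twist M x =
     (\<Oplus>\<^bsub>M\<^esub>i\<in>{i. homog_part M x i \<noteq> \<zero>\<^bsub>M\<^esub>}. sgn_mult M i (homog_part M x i))"

locale dg_group = abelian_group M for M :: "('m, 'x) dg_scheme" (structure) +
  assumes gr_subgroup: "additive_subgroup (gr M i) M"
    and gr_direct_sum: "x \<in> carrier M \<Longrightarrow> \<exists>!f. homog_decomp M x f"
    and diff_add: "\<lbrakk>x \<in> carrier M; y \<in> carrier M\<rbrakk> \<Longrightarrow> diff M (x \<oplus> y) = diff M x \<oplus> diff M y"
    and diff_degree: "x \<in> gr M i \<Longrightarrow> diff M x \<in> gr M (i + 1)"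
    and diff_closed: "x \<in> carrier M \<Longrightarrow> diff M x \<in> carrier M"
    and diff_diff: "x \<in> carrier M \<Longrightarrow> diff M (diff M x) = \<zero>"

definition concentrated_le :: "('m, 'x) dg_scheme \<Rightarrow> int \<Rightarrow> bool" where
  "concentrated_le M k \<longleftrightarrow> (\<forall>i>k. gr M i = {\<zero>\<^bsub>M\<^esub>})"

definition cocycles :: "('m, 'x) dg_scheme \<Rightarrow> int \<Rightarrow> 'm set" where
  "cocycles M i = {x \<in> gr M i. diff M x = \<zero>\<^bsub>M\<^esub>}"

definition coboundaries :: "('m, 'x) dg_scheme \<Rightarrow> int \<Rightarrow> 'm set" where
  "coboundaries M i = diff M ` gr M (i - 1)"

text \<open>
  For a DG ring and \<open>i = 0\<close> this is the cohomology ring in degree \<open>0\<close>; otherwise only the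
  additive structure of the quotient is meaningful.
\<close>

definition cohom :: "('m, 'x) dg_scheme \<Rightarrow> int \<Rightarrow> 'm set ring" where
  "cohom M i = (M\<lparr>carrier := cocycles M i\<rparr>) Quot (coboundaries M i)"

definition cohom_class :: "('m, 'x) dg_scheme \<Rightarrow> int \<Rightarrow> 'm \<Rightarrow> 'm set" where
  "cohom_class M i x = coboundaries M i +>\<^bsub>M\<^esub> x"

text \<open>
  Induced maps on quotients are written in the style of \<^const>\<open>rcoset_mult\<close>: the union is over
  all representatives, whose images all lie in the same coset.
\<close>

definition cohom_map :: "('n, 'y) dg_scheme \<Rightarrow> int \<Rightarrow> ('m \<Rightarrow> 'n) \<Rightarrow> 'm set \<Rightarrow> 'n set" where
  "cohom_map N i f X = (\<Union>x\<in>X. cohom_class N i (f x))"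


section \<open>DG rings and DG modules\<close>

locale dg_ring = ring A + dg_group A for A :: "('a, 'x) dg_scheme" (structure) +
  assumes one_degree: "\<one> \<in> gr A 0"
    and mult_degree: "\<lbrakk>a \<in> gr A i; b \<in> gr A j\<rbrakk> \<Longrightarrow> a \<otimes> b \<in> gr A (i + j)"
    and leibniz: "\<lbrakk>a \<in> gr A i; b \<in> carrier A\<rbrakk> \<Longrightarrow>
      diff A (a \<otimes> b) = diff A a \<otimes> b \<oplus> sgn_mult A i (a \<otimes> diff A b)"

locale central_dg_ring = K?: cring K + A?: dg_ring A
  for K :: "('k, 'y) ring_scheme" (structure) and A :: "('a, 'x) dg_scheme" (structure) +
  fixes \<iota> :: "'k \<Rightarrow> 'a"
  assumes struct_hom: "\<iota> \<in> ring_hom K A"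
    and struct_degree: "k \<in> carrier K \<Longrightarrow> \<iota> k \<in> gr A 0"
    and struct_cocycle: "k \<in> carrier K \<Longrightarrow> diff A (\<iota> k) = \<zero>\<^bsub>A\<^esub>"
    and struct_central: "\<lbrakk>k \<in> carrier K; a \<in> carrier A\<rbrakk> \<Longrightarrow> \<iota> k \<otimes>\<^bsub>A\<^esub> a = a \<otimes>\<^bsub>A\<^esub> \<iota> k"

definition nonpositive :: "('a, 'x) dg_scheme \<Rightarrow> bool" where
  "nonpositive A \<longleftrightarrow> concentrated_le A 0"

record ('a, 'n) left_dg = "'n dg" +
  lact :: "'a \<Rightarrow> 'n \<Rightarrow> 'n"

record ('a, 'm) right_dg = "'m dg" +
  ract :: "'m \<Rightarrow> 'a \<Rightarrow> 'm"

locale left_dg_module = A?: dg_ring A + N?: dg_group N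
  for A :: "('a, 'x) dg_scheme" (structure) and N :: "('a, 'n) left_dg" (structure) +
  assumes lact_closed: "\<lbrakk>a \<in> carrier A; n \<in> carrier N\<rbrakk> \<Longrightarrow> lact N a n \<in> carrier N"
    and lact_add_left: "\<lbrakk>a \<in> carrier A; b \<in> carrier A; n \<in> carrier N\<rbrakk> \<Longrightarrow>
      lact N (a \<oplus>\<^bsub>A\<^esub> b) n = lact N a n \<oplus>\<^bsub>N\<^esub> lact N b n"
    and lact_add_right: "\<lbrakk>a \<in> carrier A; n \<in> carrier N; n' \<in> carrier N\<rbrakk> \<Longrightarrow>
      lact N a (n \<oplus>\<^bsub>N\<^esub> n') = lact N a n \<oplus>\<^bsub>N\<^esub> lact N a n'"
    and lact_assoc: "\<lbrakk>a \<in> carrier A; b \<in> carrier A; n \<in> carrier N\<rbrakk> \<Longrightarrow>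
      lact N (a \<otimes>\<^bsub>A\<^esub> b) n = lact N a (lact N b n)"
    and lact_one: "n \<in> carrier N \<Longrightarrow> lact N \<one>\<^bsub>A\<^esub> n = n"
    and lact_degree: "\<lbrakk>a \<in> gr A i; n \<in> gr N j\<rbrakk> \<Longrightarrow> lact N a n \<in> gr N (i + j)"
    and lact_leibniz: "\<lbrakk>a \<in> gr A i; n \<in> carrier N\<rbrakk> \<Longrightarrow>
      diff N (lact N a n) = lact N (diff A a) n \<oplus>\<^bsub>N\<^esub> sgn_mult N i (lact N a (diff N n))"

locale right_dg_module = A?: dg_ring A + M?: dg_group M
  for A :: "('a, 'x) dg_scheme" (structure) and M :: "('a, 'm) right_dg" (structure) +
  assumes ract_closed: "\<lbrakk>m \<in> carrier M; a \<in> carrier A\<rbrakk> \<Longrightarrow> ract M m a \<in> carrier M"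
    and ract_add_right: "\<lbrakk>m \<in> carrier M; a \<in> carrier A; b \<in> carrier A\<rbrakk> \<Longrightarrow>
      ract M m (a \<oplus>\<^bsub>A\<^esub> b) = ract M m a \<oplus>\<^bsub>M\<^esub> ract M m b"
    and ract_add_left: "\<lbrakk>m \<in> carrier M; m' \<in> carrier M; a \<in> carrier A\<rbrakk> \<Longrightarrow>
      ract M (m \<oplus>\<^bsub>M\<^esub> m') a = ract M m a \<oplus>\<^bsub>M\<^esub> ract M m' a"
    and ract_assoc: "\<lbrakk>m \<in> carrier M; a \<in> carrier A; b \<in> carrier A\<rbrakk> \<Longrightarrow>
      ract M m (a \<otimes>\<^bsub>A\<^esub> b) = ract M (ract M m a) b"
    and ract_one: "m \<in> carrier M \<Longrightarrow> ract M m \<one>\<^bsub>A\<^esub> = m"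
    and ract_degree: "\<lbrakk>m \<in> gr M i; a \<in> gr A j\<rbrakk> \<Longrightarrow> ract M m a \<in> gr M (i + j)"
    and ract_leibniz: "\<lbrakk>m \<in> gr M i; a \<in> carrier A\<rbrakk> \<Longrightarrow>
      diff M (ract M m a) = ract M (diff M m) a \<oplus>\<^bsub>M\<^esub> sgn_mult M i (ract M m (diff A a))"

definition strict_group_hom ::
    "('m, 'x) dg_scheme \<Rightarrow> ('n, 'y) dg_scheme \<Rightarrow> ('m \<Rightarrow> 'n) \<Rightarrow> bool" where
  "strict_group_hom M N f \<longleftrightarrow>
     f \<in> carrier M \<rightarrow> carrier N \<and>
     (\<forall>x\<in>carrier M. \<forall>y\<in>carrier M. f (x \<oplus>\<^bsub>M\<^esub> y) = f x \<oplus>\<^bsub>N\<^esub> f y) \<and>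
     (\<forall>i. f ` gr M i \<subseteq> gr N i) \<and>
     (\<forall>x\<in>carrier M. f (diff M x) = diff N (f x))"

definition strict_left_hom ::
    "('a, 'x) dg_scheme \<Rightarrow> ('a, 'n) left_dg \<Rightarrow> ('a, 'n') left_dg \<Rightarrow> ('n \<Rightarrow> 'n') \<Rightarrow> bool" where
  "strict_left_hom A N N' g \<longleftrightarrow> strict_group_hom N N' g \<and>
     (\<forall>a\<in>carrier A. \<forall>n\<in>carrier N. g (lact N a n) = lact N' a (g n))"

definition strict_right_hom ::
    "('a, 'x) dg_scheme \<Rightarrow> ('a, 'm) right_dg \<Rightarrow> ('a, 'm') right_dg \<Rightarrow> ('m \<Rightarrow> 'm') \<Rightarrow> bool" where
  "strict_right_hom A M M' f \<longleftrightarrow> strict_group_hom M M' f \<and>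
     (\<forall>a\<in>carrier A. \<forall>m\<in>carrier M. f (ract M m a) = ract M' (f m) a)"

text \<open>The actions of \<open>H\<^sup>0(A)\<close> on the cohomology of DG modules.\<close>

definition cohom_lact :: "('a, 'n) left_dg \<Rightarrow> int \<Rightarrow> 'a set \<Rightarrow> 'n set \<Rightarrow> 'n set" where
  "cohom_lact N i X Y = (\<Union>a\<in>X. \<Union>n\<in>Y. cohom_class N i (lact N a n))"

definition cohom_ract :: "('a, 'm) right_dg \<Rightarrow> int \<Rightarrow> 'm set \<Rightarrow> 'a set \<Rightarrow> 'm set" where
  "cohom_ract M i Y X = (\<Union>m\<in>Y. \<Union>a\<in>X. cohom_class M i (ract M m a))"


section \<open>Tensor products over a noncommutative ring\<close>

text \<open>
  The tensor product over \<open>R\<close> of a right module \<open>P\<close> (with action \<open>\<rho>\<close>) and a left module \<open>Q\<close>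
  (with action \<open>\<mu>\<close>) is the free abelian group on \<open>P \<times> Q\<close> modulo the biadditivity and
  balancing relations. For a central \<open>K\<close>-ring \<open>R\<close> the scalars \<open>K\<close> act through \<open>R\<close>, so balancing
  over \<open>K\<close> is contained in the last family and this is the quotient of the tensor product over
  \<open>K\<close> by the relations \<open>(x r) \<otimes> y = x \<otimes> (r y)\<close>.
\<close>

definition free_ab :: "'p set \<Rightarrow> ('p \<Rightarrow>\<^sub>0 int) ring" where
  "free_ab S =
     \<lparr>carrier = carrier (free_Abelian_group S), monoid.mult = undefined, one = undefined,
      ring.zero = 0, add = (+)\<rparr>"

definition tensor_rels :: "('r, 'x) ring_scheme \<Rightarrow>
    ('p, 'y) ring_scheme \<Rightarrow> ('p \<Rightarrow> 'r \<Rightarrow> 'p) \<Rightarrow>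
    ('q, 'z) ring_scheme \<Rightarrow> ('r \<Rightarrow> 'q \<Rightarrow> 'q) \<Rightarrow> ('p \<times> 'q \<Rightarrow>\<^sub>0 int) set" where
  "tensor_rels R P \<rho> Q \<mu> =
     {frag_of (x \<oplus>\<^bsub>P\<^esub> x', y) - frag_of (x, y) - frag_of (x', y) | x x' y.
        x \<in> carrier P \<and> x' \<in> carrier P \<and> y \<in> carrier Q} \<union>
     {frag_of (x, y \<oplus>\<^bsub>Q\<^esub> y') - frag_of (x, y) - frag_of (x, y') | x y y'.
        x \<in> carrier P \<and> y \<in> carrier Q \<and> y' \<in> carrier Q} \<union>
     {frag_of (\<rho> x r, y) - frag_of (x, \<mu> r y) | x r y.
        x \<in> carrier P \<and> r \<in> carrier R \<and> y \<in> carrier Q}"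

definition tensor_ker :: "('r, 'x) ring_scheme \<Rightarrow>
    ('p, 'y) ring_scheme \<Rightarrow> ('p \<Rightarrow> 'r \<Rightarrow> 'p) \<Rightarrow>
    ('q, 'z) ring_scheme \<Rightarrow> ('r \<Rightarrow> 'q \<Rightarrow> 'q) \<Rightarrow> ('p \<times> 'q \<Rightarrow>\<^sub>0 int) set" where
  "tensor_ker R P \<rho> Q \<mu> =
     generate (free_Abelian_group (carrier P \<times> carrier Q)) (tensor_rels R P \<rho> Q \<mu>)"

definition tensor_group :: "('r, 'x) ring_scheme \<Rightarrow>
    ('p, 'y) ring_scheme \<Rightarrow> ('p \<Rightarrow> 'r \<Rightarrow> 'p) \<Rightarrow>
    ('q, 'z) ring_scheme \<Rightarrow> ('r \<Rightarrow> 'q \<Rightarrow> 'q) \<Rightarrow> ('p \<times> 'q \<Rightarrow>\<^sub>0 int) set ring" where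
  "tensor_group R P \<rho> Q \<mu> = free_ab (carrier P \<times> carrier Q) Quot tensor_ker R P \<rho> Q \<mu>"

definition tensor_class :: "('r, 'x) ring_scheme \<Rightarrow>
    ('p, 'y) ring_scheme \<Rightarrow> ('p \<Rightarrow> 'r \<Rightarrow> 'p) \<Rightarrow>
    ('q, 'z) ring_scheme \<Rightarrow> ('r \<Rightarrow> 'q \<Rightarrow> 'q) \<Rightarrow>
    ('p \<times> 'q \<Rightarrow>\<^sub>0 int) \<Rightarrow> ('p \<times> 'q \<Rightarrow>\<^sub>0 int) set" where
  "tensor_class R P \<rho> Q \<mu> t =
     tensor_ker R P \<rho> Q \<mu> +>\<^bsub>free_ab (carrier P \<times> carrier Q)\<^esub> t"

definition pure_tensor :: "('r, 'x) ring_scheme \<Rightarrow>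
    ('p, 'y) ring_scheme \<Rightarrow> ('p \<Rightarrow> 'r \<Rightarrow> 'p) \<Rightarrow>
    ('q, 'z) ring_scheme \<Rightarrow> ('r \<Rightarrow> 'q \<Rightarrow> 'q) \<Rightarrow>
    'p \<Rightarrow> 'q \<Rightarrow> ('p \<times> 'q \<Rightarrow>\<^sub>0 int) set" where
  "pure_tensor R P \<rho> Q \<mu> x y = tensor_class R P \<rho> Q \<mu> (frag_of (x, y))"

text \<open>
  The additive map out of a tensor product, into the tensor product given by the first five
  arguments, induced by the additive extension of \<open>g\<close> to the free abelian group.
\<close>

definition tensor_lift :: "('r, 'x) ring_scheme \<Rightarrow>
    ('p, 'y) ring_scheme \<Rightarrow> ('p \<Rightarrow> 'r \<Rightarrow> 'p) \<Rightarrow>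
    ('q, 'z) ring_scheme \<Rightarrow> ('r \<Rightarrow> 'q \<Rightarrow> 'q) \<Rightarrow>
    ('s \<Rightarrow> ('p \<times> 'q \<Rightarrow>\<^sub>0 int)) \<Rightarrow> ('s \<Rightarrow>\<^sub>0 int) set \<Rightarrow> ('p \<times> 'q \<Rightarrow>\<^sub>0 int) set" where
  "tensor_lift R P \<rho> Q \<mu> g T = (\<Union>t\<in>T. tensor_class R P \<rho> Q \<mu> (frag_extend g t))"

text \<open>\<open>f \<otimes> g\<close>, with codomain given by the first five arguments.\<close>

definition tensor_map :: "('r, 'x) ring_scheme \<Rightarrow>
    ('p, 'y) ring_scheme \<Rightarrow> ('p \<Rightarrow> 'r \<Rightarrow> 'p) \<Rightarrow>
    ('q, 'z) ring_scheme \<Rightarrow> ('r \<Rightarrow> 'q \<Rightarrow> 'q) \<Rightarrow>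
    ('p0 \<Rightarrow> 'p) \<Rightarrow> ('q0 \<Rightarrow> 'q) \<Rightarrow> ('p0 \<times> 'q0 \<Rightarrow>\<^sub>0 int) set \<Rightarrow> ('p \<times> 'q \<Rightarrow>\<^sub>0 int) set" where
  "tensor_map R P \<rho> Q \<mu> f g =
     tensor_lift R P \<rho> Q \<mu> (\<lambda>(x, y). frag_of (f x, g y))"

text \<open>The tensor product of DG modules over \<open>A\<close>, as a DG \<open>K\<close>-module with
  \<open>k (m \<otimes> n) = (m \<iota>(k)) \<otimes> n\<close>.\<close>

definition dg_tensor :: "('a, 'x) dg_scheme \<Rightarrow> ('k \<Rightarrow> 'a) \<Rightarrow>
    ('a, 'm) right_dg \<Rightarrow> ('a, 'n) left_dg \<Rightarrow> ('k, ('m \<times> 'n \<Rightarrow>\<^sub>0 int) set) left_dg" where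
  "dg_tensor A \<iota> M N =
     (let T = tensor_group A M (ract M) N (lact N) in
      \<lparr>carrier = carrier T, monoid.mult = undefined, one = undefined, ring.zero = \<zero>\<^bsub>T\<^esub>, add = add T,
       gr = (\<lambda>k. generate (add_monoid T)
         {pure_tensor A M (ract M) N (lact N) m n | m n i j.
            m \<in> gr M i \<and> n \<in> gr N j \<and> i + j = k}),
       diff = tensor_lift A M (ract M) N (lact N)
         (\<lambda>(m, n). frag_of (diff M m, n) + frag_of (sgn_twist M m, diff N n)),
       lact = (\<lambda>k. tensor_map A M (ract M) N (lact N) (\<lambda>m. ract M m (\<iota> k)) id)\<rparr>)"

definition dg_pure :: "('a, 'x) dg_scheme \<Rightarrow>
    ('a, 'm) right_dg \<Rightarrow> ('a, 'n) left_dg \<Rightarrow> 'm \<Rightarrow> 'n \<Rightarrow> ('m \<times> 'n \<Rightarrow>\<^sub>0 int) set" where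
  "dg_pure A M N = pure_tensor A M (ract M) N (lact N)"

definition dg_tensor_map :: "('a, 'x) dg_scheme \<Rightarrow>
    ('a, 'm') right_dg \<Rightarrow> ('a, 'n') left_dg \<Rightarrow> ('m \<Rightarrow> 'm') \<Rightarrow> ('n \<Rightarrow> 'n') \<Rightarrow>
    ('m \<times> 'n \<Rightarrow>\<^sub>0 int) set \<Rightarrow> ('m' \<times> 'n' \<Rightarrow>\<^sub>0 int) set" where
  "dg_tensor_map A M' N' = tensor_map A M' (ract M') N' (lact N')"


section \<open>The two \<open>K\<close>-modules and the comparison isomorphism\<close>

definition kmodule_iso ::
    "('k, 'x) ring_scheme \<Rightarrow> ('k, 'p) module \<Rightarrow> ('k, 'q) module \<Rightarrow> ('p \<Rightarrow> 'q) \<Rightarrow> bool" where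
  "kmodule_iso K P Q f \<longleftrightarrow>
     module K P \<and> module K Q \<and> bij_betw f (carrier P) (carrier Q) \<and>
     (\<forall>x\<in>carrier P. \<forall>y\<in>carrier P. f (x \<oplus>\<^bsub>P\<^esub> y) = f x \<oplus>\<^bsub>Q\<^esub> f y) \<and>
     (\<forall>k\<in>carrier K. \<forall>x\<in>carrier P. f (k \<odot>\<^bsub>P\<^esub> x) = k \<odot>\<^bsub>Q\<^esub> f x)"

definition cohom_kmodule :: "('k, 'x) left_dg \<Rightarrow> int \<Rightarrow> ('k, 'x set) module" where
  "cohom_kmodule X i = ring.extend (cohom X i)
     (module.fields (\<lambda>k. cohom_map X i (lact X k)))"

text \<open>
  The tensor product of \<open>H\<^sup>i(M)\<close> and \<open>H\<^sup>j(N)\<close> over \<open>H\<^sup>0(A)\<close>, where \<open>k\<close> in \<open>K\<close> acts as the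
  class of \<open>\<iota>(k)\<close> in \<open>H\<^sup>0(A)\<close>.
\<close>

definition cohom_tensor :: "('a, 'x) dg_scheme \<Rightarrow> ('k \<Rightarrow> 'a) \<Rightarrow> int \<Rightarrow> int \<Rightarrow>
    ('a, 'm) right_dg \<Rightarrow> ('a, 'n) left_dg \<Rightarrow> ('k, ('m set \<times> 'n set \<Rightarrow>\<^sub>0 int) set) module" where
  "cohom_tensor A \<iota> i j M N = ring.extend
     (tensor_group (cohom A 0) (cohom M i) (cohom_ract M i) (cohom N j) (cohom_lact N j))
     (module.fields (\<lambda>k. tensor_map (cohom A 0) (cohom M i) (cohom_ract M i) (cohom N j) (cohom_lact N j)
        (\<lambda>X. cohom_ract M i X (cohom_class A 0 (\<iota> k))) id))"

definition cohom_pure :: "('a, 'x) dg_scheme \<Rightarrow> int \<Rightarrow> int \<Rightarrow>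
    ('a, 'm) right_dg \<Rightarrow> ('a, 'n) left_dg \<Rightarrow>
    'm set \<Rightarrow> 'n set \<Rightarrow> ('m set \<times> 'n set \<Rightarrow>\<^sub>0 int) set" where
  "cohom_pure A i j M N =
     pure_tensor (cohom A 0) (cohom M i) (cohom_ract M i) (cohom N j) (cohom_lact N j)"

definition cohom_tensor_map :: "('a, 'x) dg_scheme \<Rightarrow> int \<Rightarrow> int \<Rightarrow>
    ('a, 'm') right_dg \<Rightarrow> ('a, 'n') left_dg \<Rightarrow> ('m \<Rightarrow> 'm') \<Rightarrow> ('n \<Rightarrow> 'n') \<Rightarrow>
    ('m set \<times> 'n set \<Rightarrow>\<^sub>0 int) set \<Rightarrow> ('m' set \<times> 'n' set \<Rightarrow>\<^sub>0 int) set" where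
  "cohom_tensor_map A i j M' N' f g =
     tensor_map (cohom A 0) (cohom M' i) (cohom_ract M' i) (cohom N' j) (cohom_lact N' j)
       (cohom_map M' i f) (cohom_map N' j g)"

text \<open>Extensionality makes \<open>\<theta>\<close> a function on the carrier, so that it can be unique as a
  HOL function.\<close>

definition is_theta :: "('k, 'y) ring_scheme \<Rightarrow> ('a, 'x) dg_scheme \<Rightarrow> ('k \<Rightarrow> 'a) \<Rightarrow> int \<Rightarrow> int \<Rightarrow>
    ('a, 'm) right_dg \<Rightarrow> ('a, 'n) left_dg \<Rightarrow>
    (('m set \<times> 'n set \<Rightarrow>\<^sub>0 int) set \<Rightarrow> ('m \<times> 'n \<Rightarrow>\<^sub>0 int) set set) \<Rightarrow> bool" where
  "is_theta K A \<iota> i j M N \<theta> \<longleftrightarrow>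
     \<theta> \<in> extensional (carrier (cohom_tensor A \<iota> i j M N)) \<and>
     kmodule_iso K (cohom_tensor A \<iota> i j M N) (cohom_kmodule (dg_tensor A \<iota> M N) (i + j)) \<theta> \<and>
     (\<forall>m\<in>gr M i. \<forall>n\<in>gr N j.
        \<theta> (cohom_pure A i j M N (cohom_class M i m) (cohom_class N j n)) =
        cohom_class (dg_tensor A \<iota> M N) (i + j) (dg_pure A M N m n))"

end

theory Submission
  imports Defs
begin

text \<open>
  Write \<open>t = i\<^sub>0 + j\<^sub>0\<close>. Nothing lives in degrees above \<open>i\<^sub>0\<close> in \<open>M\<close>, above \<open>j\<^sub>0\<close> in \<open>N\<close> and above
  \<open>0\<close> in \<open>A\<close>. Hence all elements of \<open>M\<close> in degree \<open>i\<^sub>0\<close>, of \<open>N\<close> in degree \<open>j\<^sub>0\<close>, of \<open>A\<close> in degree \<open>0\<close> and of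
  \<open>M \<otimes>\<^sub>A N\<close> in degree \<open>t\<close> are cocycles, and the degree \<open>t\<close> part of \<open>M \<otimes>\<^sub>A N\<close> is generated by the
  \<open>m \<otimes> n\<close> with \<open>m\<close> of degree \<open>i\<^sub>0\<close> and \<open>n\<close> of degree \<open>j\<^sub>0\<close>.

  Since \<open>du \<otimes> n = d(u \<otimes> n)\<close> and \<open>m \<otimes> dv = \<plusminus> d(m \<otimes> v)\<close> for \<open>m\<close> and \<open>n\<close> of top degree, the class
  \<open>[m \<otimes> n]\<close> depends only on \<open>[m]\<close> and \<open>[n]\<close> (\<open>class_pure_cong\<close>), and the universal property of the
  tensor product over \<open>H\<^sup>0(A)\<close> (\<open>tensor_universal\<close>) gives an additive map \<open>\<theta>\<close> with
  \<open>\<theta>([m] \<otimes> [n]) = [m \<otimes> n]\<close>. It is surjective because these classes generate the target.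

  Injectivity comes from a map in the other direction that is defined on all of \<open>M \<otimes>\<^sub>A N\<close>: if \<open>m\<^sub>i\<close>
  denotes the component of \<open>m\<close> in degree \<open>i\<close>, and \<open>p = i\<^sub>0\<close>, \<open>q = j\<^sub>0\<close>, then
  \<open>\<psi>(m \<otimes> n) = [m\<^sub>p] \<otimes> [n\<^sub>q]\<close> respects the balancing relation, because the degree bounds give
  \<open>(m a)\<^sub>p = m\<^sub>p a\<^sub>0\<close> and \<open>(a n)\<^sub>q = a\<^sub>0 n\<^sub>q\<close> (\<open>homog_part_ract\<close>, \<open>homog_part_lact\<close>,
  \<open>retraction_exists\<close>). It kills the coboundaries in degree \<open>t\<close> (\<open>retraction_coboundary\<close>), so \<open>\<psi>\<close> maps
  every representative of \<open>\<theta>(x)\<close> to \<open>x\<close> (\<open>theta_bij\<close>). The direct sum decomposition of \<open>M \<otimes>\<^sub>A N\<close> into its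
  degrees is never needed.

  Linearity over \<open>K\<close>, uniqueness and functoriality are identities between additive maps on a tensor
  product, and are checked on pure tensors.
\<close>

section \<open>Abelian groups and their quotients\<close>

context abelian_group
begin

lemma minus_eq_zero_iff:
  assumes "x \<in> carrier G" "y \<in> carrier G"
  shows "x \<ominus> y = \<zero> \<longleftrightarrow> x = y"
proof
  assume "x \<ominus> y = \<zero>"
  then have "\<ominus> (\<ominus> y) = x"
    using assms by (intro minus_equality) (auto simp: minus_eq)
  then show "x = y" using assms by simp
qed (use assms in \<open>simp add: minus_eq r_neg\<close>)

lemma sgn_mult_closed: "x \<in> carrier G \<Longrightarrow> sgn_mult G i x \<in> carrier G"
  by (simp add: sgn_mult_def)

lemma sgn_mult_add:
  "\<lbrakk>x \<in> carrier G; y \<in> carrier G\<rbrakk> \<Longrightarrow> sgn_mult G i (x \<oplus> y) = sgn_mult G i x \<oplus> sgn_mult G i y"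
  by (simp add: sgn_mult_def minus_add)

lemma sgn_mult_zero: "sgn_mult G i \<zero> = \<zero>"
  using minus_equality[of \<zero> \<zero>] by (simp add: sgn_mult_def)

lemma sgn_mult_0 [simp]: "sgn_mult G 0 x = x"
  by (simp add: sgn_mult_def)

lemma sgn_mult_sgn_mult:
  "x \<in> carrier G \<Longrightarrow> sgn_mult G i (sgn_mult G j x) = sgn_mult G (i + j) x"
  by (simp add: sgn_mult_def)

end

lemma (in abelian_group_hom) hom_sgn_mult:
  "x \<in> carrier G \<Longrightarrow> h (sgn_mult G i x) = sgn_mult H i (h x)"
  by (simp add: sgn_mult_def)

lemma abelian_group_transfer:
  fixes G :: "('g, 'x) ring_scheme" and H :: "('g, 'y) ring_scheme"
  assumes "abelian_group G" "carrier H = carrier G" "\<zero>\<^bsub>H\<^esub> = \<zero>\<^bsub>G\<^esub>" "add H = add G"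
  shows "abelian_group H"
proof -
  interpret G: abelian_group G by fact
  show ?thesis
    using assms(2-4) G.l_neg by (intro abelian_groupI) (auto simp: G.a_ac intro!: G.l_neg)
qed

lemma abelian_group_hom_intro:
  assumes "abelian_group G" "abelian_group H"
    and "\<And>x. x \<in> carrier G \<Longrightarrow> h x \<in> carrier H"
    and "\<And>x y. \<lbrakk>x \<in> carrier G; y \<in> carrier G\<rbrakk> \<Longrightarrow> h (x \<oplus>\<^bsub>G\<^esub> y) = h x \<oplus>\<^bsub>H\<^esub> h y"
  shows "abelian_group_hom G H h"
proof (rule abelian_group_homI)
  interpret G: abelian_group G by fact
  interpret H: abelian_group H by fact
  show "group_hom (add_monoid G) (add_monoid H) h"
    using assms(3,4)
    by (intro group_hom.intro group_hom_axioms.intro G.a_group H.a_group homI) auto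
qed fact+

lemma abelian_group_hom_transfer:
  assumes "abelian_group_hom G H h" "abelian_group G'" "abelian_group H'"
    and "carrier G' = carrier G" "add G' = add G" "carrier H' = carrier H" "add H' = add H"
  shows "abelian_group_hom G' H' h"
  using assms abelian_group_hom.hom_closed[OF assms(1)] abelian_group_hom.hom_add[OF assms(1)]
  by (intro abelian_group_hom_intro) auto

lemma abelian_group_hom_comp:
  assumes "abelian_group_hom G H f" "abelian_group_hom H L g"
  shows "abelian_group_hom G L (\<lambda>x. g (f x))"
proof -
  interpret f: abelian_group_hom G H f by fact
  interpret g: abelian_group_hom H L g by fact
  show ?thesis
    by (rule abelian_group_hom_intro) (auto simp: f.G.abelian_group_axioms g.H.abelian_group_axioms)
qed

context abelian_subgroup
begin

lemma abelian_group_quot: "abelian_group (G Quot H)"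
proof -
  have "comm_group (add_monoid (G Quot H))"
    using a_factorgroup_is_comm_group by (simp add: FactRing_def A_FactGroup_def')
  then show ?thesis
    by (simp add: abelian_group_def abelian_group_axioms_def abelian_monoid_def comm_group.axioms(1))
qed

lemma carrier_quot: "carrier (G Quot H) = (\<lambda>x. H +> x) ` carrier G"
  by (auto simp: FactRing_def A_RCOSETS_def')

lemma zero_quot: "\<zero>\<^bsub>G Quot H\<^esub> = H"
  by (simp add: FactRing_def)

lemma add_quot:
  "\<lbrakk>x \<in> carrier G; y \<in> carrier G\<rbrakk> \<Longrightarrow> (H +> x) \<oplus>\<^bsub>G Quot H\<^esub> (H +> y) = H +> (x \<oplus> y)"
  by (simp add: FactRing_def a_rcos_sum)

lemma rcos_hom: "abelian_group_hom G (G Quot H) (\<lambda>x. H +> x)"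
  by (rule abelian_group_hom_intro)
    (auto simp: abelian_group_quot abelian_group_axioms carrier_quot add_quot)

lemma rcos_repr:
  assumes "x \<in> carrier G" "y \<in> H +> x"
  shows "y \<in> carrier G" "H +> y = H +> x"
  using assms a_elemrcos_carrier a_repr_independence' by blast+

text \<open>An additive map that vanishes on \<open>H\<close> is constant on cosets, so that the union over all
  representatives is its common value.\<close>

lemma hom_const_on_rcos:
  assumes "abelian_group_hom G L k" "\<And>h. h \<in> H \<Longrightarrow> k h = \<zero>\<^bsub>L\<^esub>" "x \<in> carrier G" "y \<in> H +> x"
  shows "k y = k x"
proof -
  interpret k: abelian_group_hom G L k by fact
  obtain h where h: "h \<in> H" "y = h \<oplus> x"
    using assms(4) by (auto simp: a_r_coset_def')
  then show ?thesis
    using assms(2,3) by simp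
qed

lemma UN_rcos:
  assumes "abelian_group_hom G L k" "\<And>h. h \<in> H \<Longrightarrow> k h = \<zero>\<^bsub>L\<^esub>" "x \<in> carrier G"
  shows "(\<Union>y\<in>H +> x. k y) = k x"
  using hom_const_on_rcos[OF assms] a_rcos_self[OF assms(3)] by blast

end


section \<open>The universal property of the tensor product\<close>

lemma add_monoid_free_ab: "add_monoid (free_ab S) = free_Abelian_group S"
  by (simp add: free_ab_def free_Abelian_group_def)

lemma free_ab_simps [simp]:
  "c \<in> carrier (free_ab S) \<longleftrightarrow> Poly_Mapping.keys c \<subseteq> S"
  "\<zero>\<^bsub>free_ab S\<^esub> = 0"
  "x \<oplus>\<^bsub>free_ab S\<^esub> y = x + y"
  by (simp_all add: free_ab_def)

lemma keys_diff_subset: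
  fixes a b :: "'a \<Rightarrow>\<^sub>0 int"
  shows "\<lbrakk>Poly_Mapping.keys a \<subseteq> S; Poly_Mapping.keys b \<subseteq> S\<rbrakk> \<Longrightarrow> Poly_Mapping.keys (a - b) \<subseteq> S"
  using keys_diff[of a b] by blast

lemma abelian_group_free_ab: "abelian_group (free_ab S)"
  using abelian_free_Abelian_group[of S]
  unfolding abelian_group_def abelian_group_axioms_def abelian_monoid_def add_monoid_free_ab
  by (simp add: comm_group.axioms(1))

lemma free_ab_a_inv [simp]:
  "Poly_Mapping.keys x \<subseteq> S \<Longrightarrow> \<ominus>\<^bsub>free_ab S\<^esub> x = - x"
  unfolding a_inv_def add_monoid_free_ab by simp

lemma hom_free_ab_diff:
  assumes "abelian_group_hom (free_ab S) L h"
    and "Poly_Mapping.keys x \<subseteq> S" "Poly_Mapping.keys y \<subseteq> S"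
  shows "h (x - y) = h x \<ominus>\<^bsub>L\<^esub> h y"
proof -
  interpret h: abelian_group_hom "free_ab S" L h by fact
  have "h (x \<oplus>\<^bsub>free_ab S\<^esub> (\<ominus>\<^bsub>free_ab S\<^esub> y)) = h x \<ominus>\<^bsub>L\<^esub> h y"
    using assms(2,3) h.hom_a_inv[of y] h.G.a_inv_closed[of y]
    by (simp only: h.hom_add free_ab_simps(1) h.H.minus_eq)
  then show ?thesis
    using assms(3) by simp
qed

lemma hom_free_ab_eq:
  assumes "abelian_group_hom (free_ab S) L h" "abelian_group_hom (free_ab S) L h'"
    and "\<And>s. s \<in> S \<Longrightarrow> h (frag_of s) = h' (frag_of s)"
    and "Poly_Mapping.keys c \<subseteq> S"
  shows "h c = h' c"
  using assms(4)
proof (induction c rule: free_Abelian_group_induct[consumes 1, case_names zero diff of])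
  case zero
  show ?case
    using abelian_group_hom.hom_zero[OF assms(1)] abelian_group_hom.hom_zero[OF assms(2)] by simp
next
  case (diff x y)
  then show ?case
    by (simp add: hom_free_ab_diff[OF assms(1)] hom_free_ab_diff[OF assms(2)])
next
  case (of a)
  then show ?case by (rule assms(3))
qed

lemma free_ab_universal:
  assumes "abelian_group L" "\<And>s. s \<in> S \<Longrightarrow> f s \<in> carrier L"
  obtains h where "abelian_group_hom (free_ab S) L h" "\<And>s. s \<in> S \<Longrightarrow> h (frag_of s) = f s"
proof -
  interpret L: abelian_group L by fact
  obtain h where h: "h \<in> hom (free_Abelian_group S) (add_monoid L)" "\<And>s. s \<in> S \<Longrightarrow> h (frag_of s) = f s"
    using comm_group.free_Abelian_group_universal[OF L.a_comm_group, of f S] assms(2) by auto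
  have "abelian_group_hom (free_ab S) L h"
    using h(1) by (intro abelian_group_hom_intro assms(1) abelian_group_free_ab) (auto simp: hom_def Pi_iff)
  then show ?thesis using h(2) that by blast
qed

lemma frag_extend_hom:
  assumes "\<And>s. s \<in> S \<Longrightarrow> Poly_Mapping.keys (g s) \<subseteq> S'"
  shows "abelian_group_hom (free_ab S) (free_ab S') (frag_extend g)"
proof (rule abelian_group_hom_intro[OF abelian_group_free_ab abelian_group_free_ab])
  fix x assume "x \<in> carrier (free_ab S)"
  then show "frag_extend g x \<in> carrier (free_ab S')"
    using keys_frag_extend[of g x] assms by (fastforce simp: subset_iff)
qed (simp add: frag_extend_add)

text \<open>A pair of additive groups on which \<open>R\<close> operates. For the tensor product to be an abelian group
  with the usual universal property, the operations \<open>\<rho>\<close> and \<open>\<mu>\<close> only need to preserve the carriers.\<close>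

locale balanced_pair = P: abelian_group P + Q: abelian_group Q
  for R :: "('r, 'x) ring_scheme" and P :: "('p, 'y) ring_scheme" and \<rho> :: "'p \<Rightarrow> 'r \<Rightarrow> 'p"
    and Q :: "('q, 'z) ring_scheme" and \<mu> :: "'r \<Rightarrow> 'q \<Rightarrow> 'q" +
  assumes rho_closed: "\<lbrakk>x \<in> carrier P; r \<in> carrier R\<rbrakk> \<Longrightarrow> \<rho> x r \<in> carrier P"
    and mu_closed: "\<lbrakk>r \<in> carrier R; y \<in> carrier Q\<rbrakk> \<Longrightarrow> \<mu> r y \<in> carrier Q"
begin

abbreviation "pairs \<equiv> carrier P \<times> carrier Q"
abbreviation "kern \<equiv> tensor_ker R P \<rho> Q \<mu>"
abbreviation "tens \<equiv> tensor_group R P \<rho> Q \<mu>"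
abbreviation "cls \<equiv> tensor_class R P \<rho> Q \<mu>"
abbreviation "pure \<equiv> pure_tensor R P \<rho> Q \<mu>"

lemma tensor_rels_subset: "tensor_rels R P \<rho> Q \<mu> \<subseteq> carrier (free_Abelian_group pairs)"
proof
  fix t assume "t \<in> tensor_rels R P \<rho> Q \<mu>"
  then have "Poly_Mapping.keys t \<subseteq> pairs"
    unfolding tensor_rels_def
    by (elim UnE CollectE exE conjE; hypsubst; intro keys_diff_subset; simp add: rho_closed mu_closed)
  then show "t \<in> carrier (free_Abelian_group pairs)" by simp
qed

sublocale ker: abelian_subgroup kern "free_ab pairs"
proof (rule abelian_subgroupI3[OF additive_subgroupI abelian_group_free_ab])
  show "subgroup kern (add_monoid (free_ab pairs))"
    unfolding tensor_ker_def
    unfolding add_monoid_free_ab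
    by (rule group.generate_is_subgroup[OF group_free_Abelian_group tensor_rels_subset])
qed

sublocale T: abelian_group tens
  unfolding tensor_group_def by (rule ker.abelian_group_quot)

lemma cls_hom: "abelian_group_hom (free_ab pairs) tens cls"
  using ker.rcos_hom unfolding tensor_group_def tensor_class_def[abs_def] .

lemma carrier_tens: "carrier tens = cls ` carrier (free_ab pairs)"
  unfolding tensor_group_def ker.carrier_quot tensor_class_def by simp

lemma pure_closed [simp]: "\<lbrakk>x \<in> carrier P; y \<in> carrier Q\<rbrakk> \<Longrightarrow> pure x y \<in> carrier tens"
  unfolding pure_tensor_def carrier_tens by auto

lemma cls_kern: "t \<in> kern \<Longrightarrow> cls t = \<zero>\<^bsub>tens\<^esub>"
  unfolding tensor_class_def tensor_group_def ker.zero_quot by (rule ker.a_rcos_const)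

lemma cls_rel: "t \<in> tensor_rels R P \<rho> Q \<mu> \<Longrightarrow> cls t = \<zero>\<^bsub>tens\<^esub>"
  by (rule cls_kern) (simp add: tensor_ker_def generate.incl)

lemma cls_diff:
  "\<lbrakk>Poly_Mapping.keys a \<subseteq> pairs; Poly_Mapping.keys b \<subseteq> pairs\<rbrakk> \<Longrightarrow> cls (a - b) = cls a \<ominus>\<^bsub>tens\<^esub> cls b"
  by (rule hom_free_ab_diff[OF cls_hom])

lemma cls_add:
  "\<lbrakk>Poly_Mapping.keys a \<subseteq> pairs; Poly_Mapping.keys b \<subseteq> pairs\<rbrakk> \<Longrightarrow> cls (a + b) = cls a \<oplus>\<^bsub>tens\<^esub> cls b"
  using abelian_group_hom.hom_add[OF cls_hom, of a b] by simp

lemma minus_minus_zeroD: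
  assumes "a \<in> carrier tens" "b \<in> carrier tens" "c \<in> carrier tens"
    "a \<ominus>\<^bsub>tens\<^esub> b \<ominus>\<^bsub>tens\<^esub> c = \<zero>\<^bsub>tens\<^esub>"
  shows "a = b \<oplus>\<^bsub>tens\<^esub> c"
proof -
  have "c = (\<ominus>\<^bsub>tens\<^esub> b) \<oplus>\<^bsub>tens\<^esub> a"
    using assms T.minus_eq_zero_iff[of "a \<ominus>\<^bsub>tens\<^esub> b" c] by (simp add: T.minus_eq T.a_comm)
  then show ?thesis
    using assms(1,2) by (simp add: T.r_neg2)
qed

lemma pure_add_left:
  assumes "x \<in> carrier P" "x' \<in> carrier P" "y \<in> carrier Q"
  shows "pure (x \<oplus>\<^bsub>P\<^esub> x') y = pure x y \<oplus>\<^bsub>tens\<^esub> pure x' y"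
proof (rule minus_minus_zeroD)
  have "frag_of (x \<oplus>\<^bsub>P\<^esub> x', y) - frag_of (x, y) - frag_of (x', y) \<in> tensor_rels R P \<rho> Q \<mu>"
    using assms unfolding tensor_rels_def by blast
  from cls_rel[OF this]
  show "pure (x \<oplus>\<^bsub>P\<^esub> x') y \<ominus>\<^bsub>tens\<^esub> pure x y \<ominus>\<^bsub>tens\<^esub> pure x' y = \<zero>\<^bsub>tens\<^esub>"
    using assms by (simp add: cls_diff keys_diff_subset pure_tensor_def)
qed (use assms in simp_all)

lemma pure_add_right:
  assumes "x \<in> carrier P" "y \<in> carrier Q" "y' \<in> carrier Q"
  shows "pure x (y \<oplus>\<^bsub>Q\<^esub> y') = pure x y \<oplus>\<^bsub>tens\<^esub> pure x y'"
proof (rule minus_minus_zeroD)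
  have "frag_of (x, y \<oplus>\<^bsub>Q\<^esub> y') - frag_of (x, y) - frag_of (x, y') \<in> tensor_rels R P \<rho> Q \<mu>"
    using assms unfolding tensor_rels_def by blast
  from cls_rel[OF this]
  show "pure x (y \<oplus>\<^bsub>Q\<^esub> y') \<ominus>\<^bsub>tens\<^esub> pure x y \<ominus>\<^bsub>tens\<^esub> pure x y' = \<zero>\<^bsub>tens\<^esub>"
    using assms by (simp add: cls_diff keys_diff_subset pure_tensor_def)
qed (use assms in simp_all)

lemma pure_balanced:
  assumes "x \<in> carrier P" "r \<in> carrier R" "y \<in> carrier Q"
  shows "pure (\<rho> x r) y = pure x (\<mu> r y)"
proof -
  have "frag_of (\<rho> x r, y) - frag_of (x, \<mu> r y) \<in> tensor_rels R P \<rho> Q \<mu>"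
    using assms unfolding tensor_rels_def by blast
  from cls_rel[OF this] have "pure (\<rho> x r) y \<ominus>\<^bsub>tens\<^esub> pure x (\<mu> r y) = \<zero>\<^bsub>tens\<^esub>"
    using assms by (simp add: cls_diff rho_closed mu_closed pure_tensor_def)
  then show ?thesis
    using assms by (simp add: T.minus_eq_zero_iff rho_closed mu_closed)
qed

lemma pure_hom_left: "y \<in> carrier Q \<Longrightarrow> abelian_group_hom P tens (\<lambda>x. pure x y)"
  by (rule abelian_group_hom_intro)
    (auto simp: pure_add_left P.abelian_group_axioms T.abelian_group_axioms)

lemma pure_hom_right: "x \<in> carrier P \<Longrightarrow> abelian_group_hom Q tens (pure x)"
  by (rule abelian_group_hom_intro)
    (auto simp: pure_add_right Q.abelian_group_axioms T.abelian_group_axioms)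

lemma pure_zero [simp]:
  "y \<in> carrier Q \<Longrightarrow> pure \<zero>\<^bsub>P\<^esub> y = \<zero>\<^bsub>tens\<^esub>" "x \<in> carrier P \<Longrightarrow> pure x \<zero>\<^bsub>Q\<^esub> = \<zero>\<^bsub>tens\<^esub>"
  using abelian_group_hom.hom_zero[OF pure_hom_left] abelian_group_hom.hom_zero[OF pure_hom_right]
  by auto

lemma pure_minus_left:
  "\<lbrakk>x \<in> carrier P; y \<in> carrier Q\<rbrakk> \<Longrightarrow> \<ominus>\<^bsub>tens\<^esub> pure x y = pure (\<ominus>\<^bsub>P\<^esub> x) y"
  using abelian_group_hom.hom_a_inv[OF pure_hom_left] by simp

text \<open>Since \<open>- (x \<otimes> y) = (- x) \<otimes> y\<close>, the pure tensors generate already as a monoid.\<close>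

lemma tensor_induct [consumes 1, case_names zero pure add]:
  assumes "t \<in> carrier tens"
    and zero: "Z \<zero>\<^bsub>tens\<^esub>"
    and pure: "\<And>x y. \<lbrakk>x \<in> carrier P; y \<in> carrier Q\<rbrakk> \<Longrightarrow> Z (pure x y)"
    and add: "\<And>s t. \<lbrakk>s \<in> carrier tens; t \<in> carrier tens; Z s; Z t\<rbrakk> \<Longrightarrow> Z (s \<oplus>\<^bsub>tens\<^esub> t)"
  shows "Z t"
proof -
  obtain c where c: "Poly_Mapping.keys c \<subseteq> pairs" "t = cls c"
    using assms(1) unfolding carrier_tens by auto
  have "Z (cls c) \<and> Z (\<ominus>\<^bsub>tens\<^esub> cls c)"
    using c(1)
  proof (induction c rule: free_Abelian_group_induct[consumes 1, case_names zero diff of])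
    case zero
    have "cls 0 = \<zero>\<^bsub>tens\<^esub>"
      using abelian_group_hom.hom_zero[OF cls_hom] by simp
    moreover have "\<ominus>\<^bsub>tens\<^esub> \<zero>\<^bsub>tens\<^esub> = \<zero>\<^bsub>tens\<^esub>"
      by (rule T.minus_equality) auto
    ultimately show ?case using assms(2) by metis
  next
    case (diff a b)
    have ab: "cls a \<in> carrier tens" "cls b \<in> carrier tens"
      using diff by (auto simp: carrier_tens)
    have "\<ominus>\<^bsub>tens\<^esub> (cls a \<oplus>\<^bsub>tens\<^esub> \<ominus>\<^bsub>tens\<^esub> cls b) = (\<ominus>\<^bsub>tens\<^esub> cls a) \<oplus>\<^bsub>tens\<^esub> cls b"
      using ab by (simp add: T.minus_add)
    then show ?case
      using diff ab by (simp add: cls_diff T.minus_eq add)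
  next
    case (of s)
    then obtain x y where "s = (x, y)" "x \<in> carrier P" "y \<in> carrier Q" by auto
    then show ?case
      using pure pure_minus_left[of x y] unfolding pure_tensor_def by auto
  qed
  then show ?thesis using c by simp
qed

lemma pure_sgn_left:
  "\<lbrakk>x \<in> carrier P; y \<in> carrier Q\<rbrakk> \<Longrightarrow> pure (sgn_mult P i x) y = sgn_mult tens i (pure x y)"
  using abelian_group_hom.hom_sgn_mult[OF pure_hom_left] .

lemma pure_sgn_right:
  "\<lbrakk>x \<in> carrier P; y \<in> carrier Q\<rbrakk> \<Longrightarrow> pure x (sgn_mult Q i y) = sgn_mult tens i (pure x y)"
  using abelian_group_hom.hom_sgn_mult[OF pure_hom_right] .

lemma tensor_hom_eq:
  assumes "abelian_group_hom tens L f" "abelian_group_hom tens L g"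
    and "\<And>x y. \<lbrakk>x \<in> carrier P; y \<in> carrier Q\<rbrakk> \<Longrightarrow> f (pure x y) = g (pure x y)"
    and "t \<in> carrier tens"
  shows "f t = g t"
  using assms(4)
proof (induction rule: tensor_induct)
  case zero
  then show ?case
    using abelian_group_hom.hom_zero[OF assms(1)] abelian_group_hom.hom_zero[OF assms(2)] by simp
next
  case (pure x y)
  then show ?case by (rule assms(3))
next
  case (add s t)
  then show ?case
    using abelian_group_hom.hom_add[OF assms(1)] abelian_group_hom.hom_add[OF assms(2)] by simp
qed

lemma tensor_universal:
  assumes "abelian_group L"
    and closed: "\<And>x y. \<lbrakk>x \<in> carrier P; y \<in> carrier Q\<rbrakk> \<Longrightarrow> \<beta> x y \<in> carrier L"
    and add_left: "\<And>x x' y. \<lbrakk>x \<in> carrier P; x' \<in> carrier P; y \<in> carrier Q\<rbrakk>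
      \<Longrightarrow> \<beta> (x \<oplus>\<^bsub>P\<^esub> x') y = \<beta> x y \<oplus>\<^bsub>L\<^esub> \<beta> x' y"
    and add_right: "\<And>x y y'. \<lbrakk>x \<in> carrier P; y \<in> carrier Q; y' \<in> carrier Q\<rbrakk>
      \<Longrightarrow> \<beta> x (y \<oplus>\<^bsub>Q\<^esub> y') = \<beta> x y \<oplus>\<^bsub>L\<^esub> \<beta> x y'"
    and balanced: "\<And>x r y. \<lbrakk>x \<in> carrier P; r \<in> carrier R; y \<in> carrier Q\<rbrakk>
      \<Longrightarrow> \<beta> (\<rho> x r) y = \<beta> x (\<mu> r y)"
  obtains h where "abelian_group_hom tens L h"
    "\<And>x y. \<lbrakk>x \<in> carrier P; y \<in> carrier Q\<rbrakk> \<Longrightarrow> h (pure x y) = \<beta> x y"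
proof -
  interpret L: abelian_group L by fact
  obtain k where k: "abelian_group_hom (free_ab pairs) L k"
    and k_of: "\<And>s. s \<in> pairs \<Longrightarrow> k (frag_of s) = \<beta> (fst s) (snd s)"
    by (rule free_ab_universal[OF assms(1), of pairs "\<lambda>s. \<beta> (fst s) (snd s)"]) (auto simp: closed)
  interpret k: abelian_group_hom "free_ab pairs" L k by fact
  have k_diff: "k (a - b) = k a \<ominus>\<^bsub>L\<^esub> k b"
    if "Poly_Mapping.keys a \<subseteq> pairs" "Poly_Mapping.keys b \<subseteq> pairs" for a b
    by (rule hom_free_ab_diff[OF k that])
  have cancel: "a \<oplus>\<^bsub>L\<^esub> b \<ominus>\<^bsub>L\<^esub> a \<ominus>\<^bsub>L\<^esub> b = \<zero>\<^bsub>L\<^esub>" if "a \<in> carrier L" "b \<in> carrier L" for a b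
  proof -
    have "a \<oplus>\<^bsub>L\<^esub> b \<ominus>\<^bsub>L\<^esub> a = (\<ominus>\<^bsub>L\<^esub> a) \<oplus>\<^bsub>L\<^esub> (a \<oplus>\<^bsub>L\<^esub> b)"
      using that by (simp add: L.minus_eq L.a_comm)
    then show ?thesis
      using that by (simp add: L.r_neg1 L.minus_eq_zero_iff)
  qed
  have k_rel: "k t = \<zero>\<^bsub>L\<^esub>" if "t \<in> tensor_rels R P \<rho> Q \<mu>" for t
    using that unfolding tensor_rels_def
    by (elim UnE CollectE exE conjE; hypsubst)
      (simp_all add: k_diff keys_diff_subset k_of add_left add_right balanced rho_closed mu_closed
        closed cancel L.minus_eq_zero_iff)
  have k_ker: "k t = \<zero>\<^bsub>L\<^esub>" if "t \<in> kern" for t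
    using that unfolding tensor_ker_def
  proof (induction rule: generate.induct)
    case one
    then show ?case using k.hom_zero by simp
  next
    case (incl h)
    then show ?case by (rule k_rel)
  next
    case (inv h)
    then have "Poly_Mapping.keys h \<subseteq> pairs"
      using subsetD[OF tensor_rels_subset inv] by simp
    then have "k (inv\<^bsub>free_Abelian_group pairs\<^esub> h) = \<ominus>\<^bsub>L\<^esub> \<zero>\<^bsub>L\<^esub>"
      using k.hom_a_inv[of h] k_rel[OF inv] by simp
    also have "\<dots> = \<zero>\<^bsub>L\<^esub>" by (rule L.minus_equality) auto
    finally show ?case .
  next
    case (eng h1 h2)
    then have "h1 \<in> kern" "h2 \<in> kern" by (simp_all add: tensor_ker_def)
    then have "h1 \<in> carrier (free_ab pairs)" "h2 \<in> carrier (free_ab pairs)"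
      using ker.a_subset by blast+
    then have "k (h1 \<oplus>\<^bsub>free_ab pairs\<^esub> h2) = \<zero>\<^bsub>L\<^esub>"
      using eng.IH by (simp only: k.hom_add L.l_zero L.zero_closed)
    then show ?case by simp
  qed
  have const: "k s = k t" if "s \<in> cls t" "Poly_Mapping.keys t \<subseteq> pairs" for s t
    using ker.hom_const_on_rcos[OF k k_ker, of t s] that unfolding tensor_class_def by simp
  define h where "h = (\<lambda>T. k (SOME t. t \<in> T))"
  have h_cls: "h (cls t) = k t" if "Poly_Mapping.keys t \<subseteq> pairs" for t
  proof -
    have "t \<in> cls t" using that ker.a_rcos_self[of t] unfolding tensor_class_def by simp
    then show ?thesis unfolding h_def by (rule someI2) (use const that in blast)
  qed
  have "abelian_group_hom tens L h"
  proof (rule abelian_group_hom_intro[OF T.abelian_group_axioms assms(1)])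
    fix x assume "x \<in> carrier tens"
    then show "h x \<in> carrier L" by (auto simp: carrier_tens h_cls)
  next
    fix x y assume "x \<in> carrier tens" "y \<in> carrier tens"
    then obtain a b where ab: "Poly_Mapping.keys a \<subseteq> pairs" "x = cls a"
      "Poly_Mapping.keys b \<subseteq> pairs" "y = cls b" by (auto simp: carrier_tens)
    have "Poly_Mapping.keys (a + b) \<subseteq> pairs" using ab keys_add[of a b] by blast
    then show "h (x \<oplus>\<^bsub>tens\<^esub> y) = h x \<oplus>\<^bsub>L\<^esub> h y"
      using ab k.hom_add[of a b] cls_add[of a b, symmetric] by (simp add: h_cls)
  qed
  moreover have "h (pure x y) = \<beta> x y" if "x \<in> carrier P" "y \<in> carrier Q" for x y
    using that by (simp add: pure_tensor_def h_cls k_of)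
  ultimately show ?thesis using that by blast
qed

end

text \<open>The induced maps between tensor products are unions over representatives. They are the maps given
  by the universal property, provided that the generator map \<open>g\<close> is biadditive and balanced modulo
  the relations of the target.\<close>

lemma tensor_lift_hom:
  fixes g :: "'p0 \<times> 'q0 \<Rightarrow> ('p \<times> 'q \<Rightarrow>\<^sub>0 int)"
  assumes "balanced_pair R0 P0 \<rho>0 Q0 \<mu>0" and "balanced_pair R P \<rho> Q \<mu>"
    and closed: "\<And>x y. \<lbrakk>x \<in> carrier P0; y \<in> carrier Q0\<rbrakk>
      \<Longrightarrow> Poly_Mapping.keys (g (x, y)) \<subseteq> carrier P \<times> carrier Q"
    and add_left: "\<And>x x' y. \<lbrakk>x \<in> carrier P0; x' \<in> carrier P0; y \<in> carrier Q0\<rbrakk>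
      \<Longrightarrow> tensor_class R P \<rho> Q \<mu> (g (x \<oplus>\<^bsub>P0\<^esub> x', y)) =
        tensor_class R P \<rho> Q \<mu> (g (x, y)) \<oplus>\<^bsub>tensor_group R P \<rho> Q \<mu>\<^esub> tensor_class R P \<rho> Q \<mu> (g (x', y))"
    and add_right: "\<And>x y y'. \<lbrakk>x \<in> carrier P0; y \<in> carrier Q0; y' \<in> carrier Q0\<rbrakk>
      \<Longrightarrow> tensor_class R P \<rho> Q \<mu> (g (x, y \<oplus>\<^bsub>Q0\<^esub> y')) =
        tensor_class R P \<rho> Q \<mu> (g (x, y)) \<oplus>\<^bsub>tensor_group R P \<rho> Q \<mu>\<^esub> tensor_class R P \<rho> Q \<mu> (g (x, y'))"
    and balanced: "\<And>x r y. \<lbrakk>x \<in> carrier P0; r \<in> carrier R0; y \<in> carrier Q0\<rbrakk>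
      \<Longrightarrow> tensor_class R P \<rho> Q \<mu> (g (\<rho>0 x r, y)) = tensor_class R P \<rho> Q \<mu> (g (x, \<mu>0 r y))"
  shows "abelian_group_hom (tensor_group R0 P0 \<rho>0 Q0 \<mu>0) (tensor_group R P \<rho> Q \<mu>)
      (tensor_lift R P \<rho> Q \<mu> g)"
    and "\<And>x y. \<lbrakk>x \<in> carrier P0; y \<in> carrier Q0\<rbrakk>
      \<Longrightarrow> tensor_lift R P \<rho> Q \<mu> g (pure_tensor R0 P0 \<rho>0 Q0 \<mu>0 x y) = tensor_class R P \<rho> Q \<mu> (g (x, y))"
proof -
  interpret S: balanced_pair R0 P0 \<rho>0 Q0 \<mu>0 by fact
  interpret D: balanced_pair R P \<rho> Q \<mu> by fact
  obtain h where h: "abelian_group_hom S.tens D.tens h"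
    and h_pure: "\<And>x y. \<lbrakk>x \<in> carrier P0; y \<in> carrier Q0\<rbrakk> \<Longrightarrow> h (S.pure x y) = D.cls (g (x, y))"
    using closed add_left add_right balanced
    by (elim S.tensor_universal[OF D.T.abelian_group_axioms, of "\<lambda>x y. D.cls (g (x, y))", rotated -1])
      (simp_all add: D.carrier_tens)
  have ext: "abelian_group_hom (free_ab S.pairs) D.tens (\<lambda>t. D.cls (frag_extend g t))"
    by (rule abelian_group_hom_comp[OF frag_extend_hom D.cls_hom]) (use closed in auto)
  have ext_eq: "D.cls (frag_extend g t) = h (S.cls t)" if "Poly_Mapping.keys t \<subseteq> S.pairs" for t
  proof (rule hom_free_ab_eq[OF ext abelian_group_hom_comp[OF S.cls_hom h] _ that])
    fix s assume "s \<in> S.pairs"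
    then show "D.cls (frag_extend g (frag_of s)) = h (S.cls (frag_of s))"
      using h_pure[of "fst s" "snd s"] by (auto simp: pure_tensor_def)
  qed
  have lift: "tensor_lift R P \<rho> Q \<mu> g T = h T" if T: "T \<in> carrier S.tens" for T
  proof -
    obtain t where t: "Poly_Mapping.keys t \<subseteq> S.pairs" "T = S.cls t"
      using T by (auto simp: S.carrier_tens)
    have "D.cls (frag_extend g s) = \<zero>\<^bsub>D.tens\<^esub>" if "s \<in> S.kern" for s
    proof -
      have "Poly_Mapping.keys s \<subseteq> S.pairs"
        using subsetD[OF S.ker.a_subset that] by simp
      then show ?thesis
        using S.cls_kern[OF that] abelian_group_hom.hom_zero[OF h] by (simp add: ext_eq)
    qed
    from S.ker.UN_rcos[OF ext this, of t] show ?thesis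
      using t ext_eq[OF t(1)] unfolding tensor_lift_def tensor_class_def[of R0] by simp
  qed
  show "abelian_group_hom S.tens D.tens (tensor_lift R P \<rho> Q \<mu> g)"
    using abelian_group_hom.hom_closed[OF h] abelian_group_hom.hom_add[OF h]
    by (intro abelian_group_hom_intro S.T.abelian_group_axioms D.T.abelian_group_axioms)
      (simp_all add: lift)
  show "tensor_lift R P \<rho> Q \<mu> g (S.pure x y) = D.cls (g (x, y))"
    if "x \<in> carrier P0" "y \<in> carrier Q0" for x y
    using that by (simp add: lift h_pure)
qed

lemma tensor_map_hom:
  assumes "balanced_pair R0 P0 \<rho>0 Q0 \<mu>0" and "balanced_pair R P \<rho> Q \<mu>"
    and f: "abelian_group_hom P0 P f" and g: "abelian_group_hom Q0 Q g"
    and balanced: "\<And>x r y. \<lbrakk>x \<in> carrier P0; r \<in> carrier R0; y \<in> carrier Q0\<rbrakk>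
      \<Longrightarrow> pure_tensor R P \<rho> Q \<mu> (f (\<rho>0 x r)) (g y) = pure_tensor R P \<rho> Q \<mu> (f x) (g (\<mu>0 r y))"
  shows "abelian_group_hom (tensor_group R0 P0 \<rho>0 Q0 \<mu>0) (tensor_group R P \<rho> Q \<mu>)
      (tensor_map R P \<rho> Q \<mu> f g)"
    and "\<And>x y. \<lbrakk>x \<in> carrier P0; y \<in> carrier Q0\<rbrakk>
      \<Longrightarrow> tensor_map R P \<rho> Q \<mu> f g (pure_tensor R0 P0 \<rho>0 Q0 \<mu>0 x y) = pure_tensor R P \<rho> Q \<mu> (f x) (g y)"
proof -
  interpret S: balanced_pair R0 P0 \<rho>0 Q0 \<mu>0 by fact
  interpret D: balanced_pair R P \<rho> Q \<mu> by fact
  interpret f: abelian_group_hom P0 P f by fact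
  interpret g: abelian_group_hom Q0 Q g by fact
  let ?g = "\<lambda>(x, y). frag_of (f x, g y)"
  have cls_g: "D.cls (?g (x, y)) = D.pure (f x) (g y)" for x y
    by (simp add: pure_tensor_def)
  have closed: "Poly_Mapping.keys (?g (x, y)) \<subseteq> D.pairs"
    if "x \<in> carrier P0" "y \<in> carrier Q0" for x y
    using that by simp
  note lift = tensor_lift_hom[OF assms(1,2), of ?g, unfolded cls_g, folded tensor_map_def, OF closed]
  show "abelian_group_hom S.tens D.tens (tensor_map R P \<rho> Q \<mu> f g)"
    by (rule lift(1)) (simp_all add: D.pure_add_left D.pure_add_right balanced)
  show "tensor_map R P \<rho> Q \<mu> f g (S.pure x y) = D.pure (f x) (g y)"
    if "x \<in> carrier P0" "y \<in> carrier Q0" for x y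
    by (rule lift(2)) (simp_all add: D.pure_add_left D.pure_add_right balanced that)
qed


text \<open>Scalars that operate on the left factor and commute with \<open>\<rho>\<close> operate on the tensor product.\<close>

context balanced_pair
begin

context
  fixes K :: "('k, 'w) ring_scheme" and s :: "'k \<Rightarrow> 'p \<Rightarrow> 'p"
  assumes cring_K: "cring K"
    and s_closed: "\<And>k x. \<lbrakk>k \<in> carrier K; x \<in> carrier P\<rbrakk> \<Longrightarrow> s k x \<in> carrier P"
    and s_add: "\<And>k x y. \<lbrakk>k \<in> carrier K; x \<in> carrier P; y \<in> carrier P\<rbrakk>
      \<Longrightarrow> s k (x \<oplus>\<^bsub>P\<^esub> y) = s k x \<oplus>\<^bsub>P\<^esub> s k y"
    and s_rho: "\<And>k x r. \<lbrakk>k \<in> carrier K; x \<in> carrier P; r \<in> carrier R\<rbrakk>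
      \<Longrightarrow> s k (\<rho> x r) = \<rho> (s k x) r"
    and add_s: "\<And>k l x. \<lbrakk>k \<in> carrier K; l \<in> carrier K; x \<in> carrier P\<rbrakk>
      \<Longrightarrow> s (k \<oplus>\<^bsub>K\<^esub> l) x = s k x \<oplus>\<^bsub>P\<^esub> s l x"
    and mult_s: "\<And>k l x. \<lbrakk>k \<in> carrier K; l \<in> carrier K; x \<in> carrier P\<rbrakk>
      \<Longrightarrow> s (k \<otimes>\<^bsub>K\<^esub> l) x = s k (s l x)"
    and one_s: "\<And>x. x \<in> carrier P \<Longrightarrow> s \<one>\<^bsub>K\<^esub> x = x"
begin

lemma smult_tensor_hom:
  assumes "k \<in> carrier K"
  shows "abelian_group_hom tens tens (tensor_map R P \<rho> Q \<mu> (s k) id)"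
    and "\<And>x y. \<lbrakk>x \<in> carrier P; y \<in> carrier Q\<rbrakk>
      \<Longrightarrow> tensor_map R P \<rho> Q \<mu> (s k) id (pure x y) = pure (s k x) y"
proof -
  have pair: "balanced_pair R P \<rho> Q \<mu>" by (rule balanced_pair_axioms)
  have hs: "abelian_group_hom P P (s k)"
    by (rule abelian_group_hom_intro)
      (use assms in \<open>auto simp: P.abelian_group_axioms s_closed s_add\<close>)
  have hid: "abelian_group_hom Q Q id"
    by (rule abelian_group_hom_intro) (auto simp: Q.abelian_group_axioms)
  have bal: "pure (s k (\<rho> x r)) (id y) = pure (s k x) (id (\<mu> r y))"
    if "x \<in> carrier P" "r \<in> carrier R" "y \<in> carrier Q" for x r y
    using that assms by (simp add: s_rho pure_balanced s_closed)
  note * = tensor_map_hom[OF pair pair hs hid bal]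
  show "abelian_group_hom tens tens (tensor_map R P \<rho> Q \<mu> (s k) id)"
    by (rule *(1))
  show "tensor_map R P \<rho> Q \<mu> (s k) id (pure x y) = pure (s k x) y"
    if "x \<in> carrier P" "y \<in> carrier Q" for x y
  proof -
    have "tensor_map R P \<rho> Q \<mu> (s k) id (pure x y) = pure (s k x) (id y)"
      by (rule *(2)) (use that in auto)
    then show ?thesis by (simp only: id_apply)
  qed
qed

lemma tensor_module:
  "module K (ring.extend tens (module.fields (\<lambda>k. tensor_map R P \<rho> Q \<mu> (s k) id)))"
    (is "module K ?T")
proof -
  let ?a = "\<lambda>k. tensor_map R P \<rho> Q \<mu> (s k) id"
  interpret K: cring K by (rule cring_K)
  have simps: "carrier ?T = carrier tens" "add ?T = add tens" "\<zero>\<^bsub>?T\<^esub> = \<zero>\<^bsub>tens\<^esub>"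
    "k \<odot>\<^bsub>?T\<^esub> x = ?a k x" for k x
    by (simp_all add: ring.defs module.defs)
  note hom = smult_tensor_hom(1) and on_pure = smult_tensor_hom(2)
  have closed: "?a k t \<in> carrier tens" if "k \<in> carrier K" "t \<in> carrier tens" for k t
    using abelian_group_hom.hom_closed[OF hom[OF that(1)] that(2)] .
  have add_hom: "abelian_group_hom tens tens (\<lambda>t. ?a k t \<oplus>\<^bsub>tens\<^esub> ?a l t)"
    if "k \<in> carrier K" "l \<in> carrier K" for k l
    using that abelian_group_hom.hom_add[OF hom]
    by (intro abelian_group_hom_intro T.abelian_group_axioms) (auto simp: closed T.a_ac)
  have id_hom: "abelian_group_hom tens tens (\<lambda>t. t)"
    by (intro abelian_group_hom_intro T.abelian_group_axioms) auto
  show ?thesis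
  proof (rule moduleI, unfold simps)
    show "abelian_group ?T"
      by (rule abelian_group_transfer[OF T.abelian_group_axioms]) (simp_all add: ring.defs)
    fix k l t u
    assume k: "k \<in> carrier K" and t: "t \<in> carrier tens"
    show "?a k t \<in> carrier tens" by (rule closed[OF k t])
    show "?a k (t \<oplus>\<^bsub>tens\<^esub> u) = ?a k t \<oplus>\<^bsub>tens\<^esub> ?a k u" if "u \<in> carrier tens"
      using abelian_group_hom.hom_add[OF hom[OF k]] t that by blast
    assume l: "l \<in> carrier K"
    show "?a (k \<oplus>\<^bsub>K\<^esub> l) t = ?a k t \<oplus>\<^bsub>tens\<^esub> ?a l t"
      by (rule tensor_hom_eq[OF hom add_hom _ t])
        (use k l in \<open>simp_all add: on_pure add_s pure_add_left s_closed\<close>)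
    show "?a (k \<otimes>\<^bsub>K\<^esub> l) t = ?a k (?a l t)"
      by (rule tensor_hom_eq[OF hom abelian_group_hom_comp[OF hom hom] _ t])
        (use k l in \<open>simp_all add: on_pure mult_s s_closed\<close>)
  next
    fix t assume t: "t \<in> carrier tens"
    show "?a \<one>\<^bsub>K\<^esub> t = t"
      by (rule tensor_hom_eq[OF hom id_hom _ t]) (simp_all add: on_pure one_s)
  qed (rule cring_K)
qed

end

end


section \<open>Homogeneous components and cohomology\<close>

context dg_group
begin

lemma gr_closed: "x \<in> gr M i \<Longrightarrow> x \<in> carrier M"
  using additive_subgroup.a_subset[OF gr_subgroup] by blast

lemma zero_gr [simp]: "\<zero> \<in> gr M i"
  by (rule additive_subgroup.zero_closed[OF gr_subgroup])

lemma add_gr: "\<lbrakk>x \<in> gr M i; y \<in> gr M i\<rbrakk> \<Longrightarrow> x \<oplus> y \<in> gr M i"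
  by (rule additive_subgroup.a_closed[OF gr_subgroup])

lemma minus_gr: "x \<in> gr M i \<Longrightarrow> \<ominus> x \<in> gr M i"
  by (rule additive_subgroup.a_inv_closed[OF gr_subgroup])

lemma diff_hom: "abelian_group_hom M M (diff M)"
  by (rule abelian_group_hom_intro) (auto simp: diff_add diff_closed abelian_group_axioms)

lemma diff_zero: "diff M \<zero> = \<zero>"
  by (rule abelian_group_hom.hom_zero[OF diff_hom])

lemma diff_minus: "x \<in> carrier M \<Longrightarrow> diff M (\<ominus> x) = \<ominus> diff M x"
  by (rule abelian_group_hom.hom_a_inv[OF diff_hom])

lemma homog_decompI:
  assumes "\<And>i. f i \<in> gr M i" "finite S" "\<And>i. i \<notin> S \<Longrightarrow> f i = \<zero>" "x = finsum M f S"
  shows "homog_decomp M x f"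
proof -
  have "{i. f i \<noteq> \<zero>} \<subseteq> S" using assms(3) by blast
  moreover have "finsum M f {i. f i \<noteq> \<zero>} = finsum M f S"
    using calculation assms(1,2) by (intro add.finprod_mono_neutral_cong_left) (auto intro: gr_closed)
  ultimately show ?thesis
    using assms finite_subset unfolding homog_decomp_def by auto
qed

lemma homog_decomp_homog_part: "x \<in> carrier M \<Longrightarrow> homog_decomp M x (homog_part M x)"
  unfolding homog_part_def by (rule theI'[OF gr_direct_sum])

lemma homog_part_eqI: "\<lbrakk>x \<in> carrier M; homog_decomp M x f\<rbrakk> \<Longrightarrow> homog_part M x = f"
  using gr_direct_sum homog_decomp_homog_part by blast

lemma homog_part_gr: "x \<in> carrier M \<Longrightarrow> homog_part M x i \<in> gr M i"
  using homog_decomp_homog_part unfolding homog_decomp_def by blast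

lemma homog_part_closed: "x \<in> carrier M \<Longrightarrow> homog_part M x i \<in> carrier M"
  by (rule gr_closed[OF homog_part_gr])

lemma finite_homog_part: "x \<in> carrier M \<Longrightarrow> finite {i. homog_part M x i \<noteq> \<zero>}"
  using homog_decomp_homog_part unfolding homog_decomp_def by blast

lemma finsum_homog_part:
  assumes "x \<in> carrier M" "finite S" "{i. homog_part M x i \<noteq> \<zero>} \<subseteq> S"
  shows "finsum M (homog_part M x) S = x"
proof -
  have "x = finsum M (homog_part M x) {i. homog_part M x i \<noteq> \<zero>}"
    using homog_decomp_homog_part[OF assms(1)] unfolding homog_decomp_def by blast
  also have "\<dots> = finsum M (homog_part M x) S"
    using assms by (intro add.finprod_mono_neutral_cong_left) (auto intro: homog_part_closed)
  finally show ?thesis by simp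
qed

lemma homog_part_add:
  assumes "x \<in> carrier M" "y \<in> carrier M"
  shows "homog_part M (x \<oplus> y) i = homog_part M x i \<oplus> homog_part M y i"
proof -
  define S where "S = {i. homog_part M x i \<noteq> \<zero>} \<union> {i. homog_part M y i \<noteq> \<zero>}"
  have S: "finite S" using assms by (auto simp: S_def finite_homog_part)
  have "homog_decomp M (x \<oplus> y) (\<lambda>i. homog_part M x i \<oplus> homog_part M y i)"
  proof (rule homog_decompI[OF _ S])
    have "finsum M (\<lambda>i. homog_part M x i \<oplus> homog_part M y i) S
        = finsum M (homog_part M x) S \<oplus> finsum M (homog_part M y) S"
      using assms by (intro add.finprod_multf) (auto intro: homog_part_closed)
    then show "x \<oplus> y = finsum M (\<lambda>i. homog_part M x i \<oplus> homog_part M y i) S"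
      using assms S by (simp add: finsum_homog_part S_def)
  qed (use assms in \<open>auto simp: S_def intro: add_gr homog_part_gr\<close>)
  then show ?thesis using homog_part_eqI[of "x \<oplus> y"] assms by simp
qed

lemma homog_part_homog:
  assumes "x \<in> gr M k"
  shows "homog_part M x i = (if i = k then x else \<zero>)"
proof -
  have "homog_decomp M x (\<lambda>i. if i = k then x else \<zero>)"
    using assms gr_closed[OF assms] by (intro homog_decompI[of _ "{k}"]) auto
  then show ?thesis using homog_part_eqI[OF gr_closed[OF assms]] by simp
qed

lemma homog_part_zero [simp]: "homog_part M \<zero> i = \<zero>"
  using homog_part_homog[OF zero_gr] by simp

lemma homog_induct [consumes 1, case_names homog add]:
  assumes "x \<in> carrier M"
    and homog: "\<And>i x. x \<in> gr M i \<Longrightarrow> Z x"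
    and add: "\<And>x y. \<lbrakk>x \<in> carrier M; y \<in> carrier M; Z x; Z y\<rbrakk> \<Longrightarrow> Z (x \<oplus> y)"
  shows "Z x"
proof -
  have "Z (finsum M (homog_part M x) S)" if "finite S" for S
    using that
  proof (induction S)
    case empty
    then show ?case using homog[OF zero_gr] by simp
  next
    case (insert i S)
    have "Z (homog_part M x i)" by (rule homog[OF homog_part_gr[OF assms(1)]])
    then show ?case
      using insert assms(1) by (simp add: homog_part_closed Pi_def add)
  qed
  from this[OF finite_homog_part[OF assms(1)]] show ?thesis
    using finsum_homog_part[OF assms(1) finite_homog_part[OF assms(1)]] by simp
qed

lemma sgn_mult_gr: "x \<in> gr M j \<Longrightarrow> sgn_mult M i x \<in> gr M j"
  by (simp add: sgn_mult_def minus_gr)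

lemma sgn_twist_eq:
  assumes "x \<in> carrier M" "finite S" "{i. homog_part M x i \<noteq> \<zero>} \<subseteq> S"
  shows "sgn_twist M x = finsum M (\<lambda>i. sgn_mult M i (homog_part M x i)) S"
  unfolding sgn_twist_def using assms
  by (intro add.finprod_mono_neutral_cong_left)
    (auto intro: homog_part_closed sgn_mult_closed simp: sgn_mult_zero)

lemma sgn_twist_closed: "x \<in> carrier M \<Longrightarrow> sgn_twist M x \<in> carrier M"
  unfolding sgn_twist_def
  by (rule add.finprod_closed) (auto intro: homog_part_closed sgn_mult_closed)

lemma sgn_twist_add:
  assumes "x \<in> carrier M" "y \<in> carrier M"
  shows "sgn_twist M (x \<oplus> y) = sgn_twist M x \<oplus> sgn_twist M y"
proof -
  define S where "S = {i. homog_part M x i \<noteq> \<zero>} \<union> {i. homog_part M y i \<noteq> \<zero>}"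
  have S: "finite S" using assms by (auto simp: S_def finite_homog_part)
  have "sgn_twist M (x \<oplus> y) = finsum M (\<lambda>i. sgn_mult M i (homog_part M (x \<oplus> y) i)) S"
    by (rule sgn_twist_eq) (use assms S in \<open>auto simp: S_def homog_part_add\<close>)
  also have "\<dots> = finsum M (\<lambda>i. sgn_mult M i (homog_part M x i) \<oplus> sgn_mult M i (homog_part M y i)) S"
    using assms by (simp add: homog_part_add sgn_mult_add homog_part_closed)
  also have "\<dots> = finsum M (\<lambda>i. sgn_mult M i (homog_part M x i)) S
      \<oplus> finsum M (\<lambda>i. sgn_mult M i (homog_part M y i)) S"
    using assms by (intro add.finprod_multf) (auto intro: homog_part_closed sgn_mult_closed)
  also have "\<dots> = sgn_twist M x \<oplus> sgn_twist M y"
    using assms S sgn_twist_eq[of x S] sgn_twist_eq[of y S] by (simp add: S_def)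
  finally show ?thesis .
qed

lemma sgn_twist_homog:
  assumes "x \<in> gr M k"
  shows "sgn_twist M x = sgn_mult M k x"
proof -
  have "{i. homog_part M x i \<noteq> \<zero>} \<subseteq> {k}"
    using assms by (auto simp: homog_part_homog)
  then show ?thesis
    using sgn_twist_eq[of x "{k}"] gr_closed[OF assms] assms
    by (simp add: homog_part_homog sgn_mult_closed)
qed

lemma sgn_twist_gr: "x \<in> gr M k \<Longrightarrow> sgn_twist M x \<in> gr M k"
  by (simp add: sgn_twist_homog sgn_mult_gr)

end

text \<open>The part of a complex that determines its cohomology in one degree: a subgroup of
  coboundaries inside a subgroup of cocycles. The grading is not required to be a direct sum.\<close>

locale cohom_degree = abelian_group X for X :: "('m, 'x) dg_scheme" (structure) and i :: int +
  assumes cocycles_subgroup: "additive_subgroup (cocycles X i) X"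
    and coboundaries_subgroup: "additive_subgroup (coboundaries X i) X"
    and coboundaries_cocycles: "coboundaries X i \<subseteq> cocycles X i"
begin

abbreviation "Z \<equiv> X\<lparr>carrier := cocycles X i\<rparr>"

lemma cocycle_closed: "x \<in> cocycles X i \<Longrightarrow> x \<in> carrier X"
  using additive_subgroup.a_subset[OF cocycles_subgroup] by blast

lemma abelian_group_cocycles: "abelian_group Z"
proof (rule abelian_groupI)
  fix x assume "x \<in> carrier Z"
  then have "x \<in> cocycles X i" by simp
  then have "(\<ominus> x) \<in> cocycles X i" "(\<ominus> x) \<oplus> x = \<zero>"
    using additive_subgroup.a_inv_closed[OF cocycles_subgroup] cocycle_closed l_neg by auto
  then show "\<exists>y\<in>carrier Z. y \<oplus>\<^bsub>Z\<^esub> x = \<zero>\<^bsub>Z\<^esub>" by auto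
qed (use cocycles_subgroup[THEN additive_subgroup.a_closed]
    cocycles_subgroup[THEN additive_subgroup.zero_closed] cocycle_closed in \<open>auto simp: a_ac\<close>)

lemma minus_cocycles:
  assumes "x \<in> cocycles X i"
  shows "\<ominus>\<^bsub>Z\<^esub> x = \<ominus> x"
proof (rule abelian_group.minus_equality[OF abelian_group_cocycles])
  show "(\<ominus> x) \<oplus>\<^bsub>Z\<^esub> x = \<zero>\<^bsub>Z\<^esub>" using assms cocycle_closed l_neg by simp
qed (use assms additive_subgroup.a_inv_closed[OF cocycles_subgroup] in auto)

sublocale B: abelian_subgroup "coboundaries X i" Z
proof (rule abelian_subgroupI3[OF additive_subgroupI abelian_group_cocycles])
  show "subgroup (coboundaries X i) (add_monoid Z)"
  proof (rule group.subgroupI)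
    show "group (add_monoid Z)"
      using abelian_group_cocycles by (rule abelian_group.a_group)
    show "inv\<^bsub>add_monoid Z\<^esub> x \<in> coboundaries X i" if "x \<in> coboundaries X i" for x
      using that additive_subgroup.a_inv_closed[OF coboundaries_subgroup that] coboundaries_cocycles
        minus_cocycles[of x] unfolding a_inv_def by auto
  qed (use coboundaries_cocycles additive_subgroup.zero_closed[OF coboundaries_subgroup]
      additive_subgroup.a_closed[OF coboundaries_subgroup] in auto)
qed

sublocale H: abelian_group "cohom X i"
  unfolding cohom_def by (rule B.abelian_group_quot)

lemma rcos_cocycles: "coboundaries X i +>\<^bsub>Z\<^esub> x = cohom_class X i x"
  by (simp add: cohom_class_def a_r_coset_def')

lemma carrier_cohom: "carrier (cohom X i) = cohom_class X i ` cocycles X i"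
  unfolding cohom_def B.carrier_quot rcos_cocycles by simp

lemma class_closed [simp]: "x \<in> cocycles X i \<Longrightarrow> cohom_class X i x \<in> carrier (cohom X i)"
  by (simp add: carrier_cohom)

lemma class_hom: "abelian_group_hom Z (cohom X i) (cohom_class X i)"
  using B.rcos_hom unfolding rcos_cocycles cohom_def .

lemma class_add:
  "\<lbrakk>x \<in> cocycles X i; y \<in> cocycles X i\<rbrakk>
    \<Longrightarrow> cohom_class X i (x \<oplus> y) = cohom_class X i x \<oplus>\<^bsub>cohom X i\<^esub> cohom_class X i y"
  using abelian_group_hom.hom_add[OF class_hom, of x y] by simp

lemma class_coboundary: "x \<in> coboundaries X i \<Longrightarrow> cohom_class X i x = \<zero>\<^bsub>cohom X i\<^esub>"
  using B.a_rcos_const unfolding rcos_cocycles cohom_def B.zero_quot by simp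

lemma class_zero: "cohom_class X i \<zero> = \<zero>\<^bsub>cohom X i\<^esub>"
  by (rule class_coboundary) (rule additive_subgroup.zero_closed[OF coboundaries_subgroup])

lemma class_self: "x \<in> cocycles X i \<Longrightarrow> x \<in> cohom_class X i x"
  using B.a_rcos_self[of x] unfolding rcos_cocycles by simp

lemma class_repr:
  assumes "x \<in> cocycles X i" "y \<in> cohom_class X i x"
  shows "y \<in> cocycles X i" "cohom_class X i y = cohom_class X i x"
  using B.rcos_repr[of x y] assms unfolding rcos_cocycles by auto

lemma class_memE:
  assumes "y \<in> cohom_class X i x"
  obtains b where "b \<in> coboundaries X i" "y = b \<oplus> x"
  using assms unfolding cohom_class_def a_r_coset_def' by auto

lemma zero_cohom: "\<zero>\<^bsub>cohom X i\<^esub> = coboundaries X i"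
  unfolding cohom_def by (rule B.zero_quot)

lemma cohom_add_memE:
  assumes "t \<in> x \<oplus>\<^bsub>cohom X i\<^esub> y"
  obtains r s where "r \<in> x" "s \<in> y" "t = r \<oplus> s"
  using assms unfolding cohom_def by (auto simp: FactRing_def set_add_def')

end

lemma (in dg_group) cohom_degree: "cohom_degree M i"
proof (intro cohom_degree.intro cohom_degree_axioms.intro)
  show "abelian_group M" by (rule abelian_group_axioms)
  show "additive_subgroup (cocycles M i) M"
  proof (rule additive_subgroupI, rule add.subgroupI)
    show "cocycles M i \<noteq> {}" using diff_zero by (auto simp: cocycles_def intro!: exI[of _ \<zero>])
  qed (auto simp: cocycles_def gr_closed minus_gr add_gr diff_add diff_minus
      intro!: minus_equality)
  show "additive_subgroup (coboundaries M i) M"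
  proof (rule additive_subgroupI, rule add.subgroupI)
    show "coboundaries M i \<noteq> {}"
      using zero_gr[of "i - 1"] unfolding coboundaries_def by blast
    fix x assume "x \<in> coboundaries M i"
    then obtain u where u: "u \<in> gr M (i - 1)" "x = diff M u" by (auto simp: coboundaries_def)
    then show "\<ominus> x \<in> coboundaries M i"
      using diff_minus[of u] minus_gr[of u] gr_closed[of u] unfolding coboundaries_def
      by (metis imageI)
    fix y assume "y \<in> coboundaries M i"
    then obtain v where v: "v \<in> gr M (i - 1)" "y = diff M v" by (auto simp: coboundaries_def)
    then show "x \<oplus> y \<in> coboundaries M i"
      using u diff_add[of u v] add_gr[of u _ v] gr_closed unfolding coboundaries_def by (metis imageI)
  qed (auto simp: coboundaries_def gr_closed diff_closed)
  show "coboundaries M i \<subseteq> cocycles M i"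
    using diff_degree[of _ "i - 1"] diff_diff gr_closed
    by (auto simp: coboundaries_def cocycles_def)
qed

lemma cohom_map_class:
  assumes "cohom_degree X i" "cohom_degree Y i"
    and f: "abelian_group_hom X Y f"
    and cocycles: "\<And>x. x \<in> cocycles X i \<Longrightarrow> f x \<in> cocycles Y i"
    and coboundaries: "\<And>x. x \<in> coboundaries X i \<Longrightarrow> f x \<in> coboundaries Y i"
  shows "\<And>x. x \<in> cocycles X i \<Longrightarrow> cohom_map Y i f (cohom_class X i x) = cohom_class Y i (f x)"
    and "abelian_group_hom (cohom X i) (cohom Y i) (cohom_map Y i f)"
proof -
  interpret X: cohom_degree X i by fact
  interpret Y: cohom_degree Y i by fact
  interpret f: abelian_group_hom X Y f by fact
  have hom: "abelian_group_hom X.Z (cohom Y i) (\<lambda>x. cohom_class Y i (f x))"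
    by (rule abelian_group_hom_intro[OF X.abelian_group_cocycles Y.H.abelian_group_axioms])
      (simp_all add: cocycles Y.class_add X.cocycle_closed)
  show eq: "cohom_map Y i f (cohom_class X i x) = cohom_class Y i (f x)" if "x \<in> cocycles X i" for x
    using X.B.UN_rcos[OF hom Y.class_coboundary[OF coboundaries]] that
    unfolding cohom_map_def X.rcos_cocycles by simp
  show "abelian_group_hom (cohom X i) (cohom Y i) (cohom_map Y i f)"
  proof (rule abelian_group_hom_intro[OF X.H.abelian_group_axioms Y.H.abelian_group_axioms])
    fix U V assume "U \<in> carrier (cohom X i)" "V \<in> carrier (cohom X i)"
    then obtain u v where uv: "u \<in> cocycles X i" "U = cohom_class X i u"
      "v \<in> cocycles X i" "V = cohom_class X i v"
      by (auto simp: X.carrier_cohom)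
    have "u \<oplus>\<^bsub>X\<^esub> v \<in> cocycles X i"
      using uv additive_subgroup.a_closed[OF X.cocycles_subgroup] by blast
    with uv show "cohom_map Y i f (U \<oplus>\<^bsub>cohom X i\<^esub> V)
        = cohom_map Y i f U \<oplus>\<^bsub>cohom Y i\<^esub> cohom_map Y i f V"
      by (simp add: eq X.cocycle_closed cocycles flip: X.class_add)
        (simp add: Y.class_add cocycles)
  qed (auto simp: X.carrier_cohom eq cocycles)
qed


section \<open>Cohomology of DG modules over the zeroth cohomology\<close>

context right_dg_module
begin

lemma ract_hom_left: "a \<in> carrier A \<Longrightarrow> abelian_group_hom M M (\<lambda>m. ract M m a)"
  by (rule abelian_group_hom_intro) (auto simp: ract_closed ract_add_left M.abelian_group_axioms)

lemma ract_hom_right: "m \<in> carrier M \<Longrightarrow> abelian_group_hom A M (ract M m)"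
  by (rule abelian_group_hom_intro)
    (auto simp: ract_closed ract_add_right M.abelian_group_axioms A.abelian_group_axioms)

lemma ract_zero [simp]:
  "a \<in> carrier A \<Longrightarrow> ract M \<zero>\<^bsub>M\<^esub> a = \<zero>\<^bsub>M\<^esub>" "m \<in> carrier M \<Longrightarrow> ract M m \<zero>\<^bsub>A\<^esub> = \<zero>\<^bsub>M\<^esub>"
  using abelian_group_hom.hom_zero[OF ract_hom_left] abelian_group_hom.hom_zero[OF ract_hom_right]
  by auto

lemma ract_cocycle:
  assumes "m \<in> cocycles M i" "a \<in> cocycles A 0"
  shows "ract M m a \<in> cocycles M i"
  using assms ract_degree[of m i a 0] ract_leibniz[of m i a] A.gr_closed[of a] M.gr_closed[of m]
  by (auto simp: cocycles_def M.sgn_mult_zero)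

lemma ract_coboundary_left:
  assumes "m \<in> coboundaries M i" "a \<in> cocycles A 0"
  shows "ract M m a \<in> coboundaries M i"
proof -
  obtain u where u: "u \<in> gr M (i - 1)" "m = diff M u"
    using assms(1) by (auto simp: coboundaries_def)
  have "ract M u a \<in> gr M (i - 1)" "diff M (ract M u a) = ract M m a"
    using assms(2) u ract_degree[of u "i - 1" a 0] ract_leibniz[of u "i - 1" a] A.gr_closed[of a]
      M.gr_closed[of u]
    by (auto simp: cocycles_def M.sgn_mult_zero ract_closed M.diff_closed)
  then show ?thesis unfolding coboundaries_def by (metis imageI)
qed

lemma ract_coboundary_right:
  assumes "m \<in> cocycles M i" "a \<in> coboundaries A 0"
  shows "ract M m a \<in> coboundaries M i"
proof -
  obtain e where e: "e \<in> gr A (- 1)" "a = diff A e"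
    using assms(2) by (auto simp: coboundaries_def)
  have m: "m \<in> gr M i" "diff M m = \<zero>\<^bsub>M\<^esub>" using assms(1) by (auto simp: cocycles_def)
  note closed = M.gr_closed[OF m(1)] A.gr_closed[OF e(1)] A.diff_closed[OF A.gr_closed[OF e(1)]]
  have "diff M (ract M m e) = sgn_mult M i (ract M m a)"
    using ract_leibniz[OF m(1) closed(2)] m(2) closed e(2)
    by (simp add: ract_closed M.sgn_mult_closed)
  then have "diff M (sgn_mult M i (ract M m e)) = ract M m a"
    using closed e(2) abelian_group_hom.hom_sgn_mult[OF M.diff_hom]
    by (simp add: ract_closed M.sgn_mult_sgn_mult) (simp add: sgn_mult_def)
  moreover have "sgn_mult M i (ract M m e) \<in> gr M (i - 1)"
    using M.sgn_mult_gr[OF ract_degree[OF m(1) e(1)]] by simp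
  ultimately show ?thesis unfolding coboundaries_def by (metis imageI)
qed

text \<open>The action of \<open>H\<^sup>0(A)\<close> on cohomology is well defined: products of a coboundary with a cocycle, in
  either order, are coboundaries.\<close>

lemma cohom_ract_class:
  assumes "m \<in> cocycles M i" "a \<in> cocycles A 0"
  shows "cohom_ract M i (cohom_class M i m) (cohom_class A 0 a) = cohom_class M i (ract M m a)"
proof -
  interpret HM: cohom_degree M i by (rule M.cohom_degree)
  interpret HA: cohom_degree A 0 by (rule A.cohom_degree)
  have "cohom_class M i (ract M m' a') = cohom_class M i (ract M m a)"
    if m': "m' \<in> cohom_class M i m" and a': "a' \<in> cohom_class A 0 a" for m' a'
  proof -
    obtain b where b: "b \<in> coboundaries M i" "m' = b \<oplus>\<^bsub>M\<^esub> m" using m' by (rule HM.class_memE)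
    obtain c where c: "c \<in> coboundaries A 0" "a' = c \<oplus>\<^bsub>A\<^esub> a" using a' by (rule HA.class_memE)
    have b': "b \<in> cocycles M i" and c': "c \<in> cocycles A 0" and ca: "a' \<in> cocycles A 0"
      using b c HM.coboundaries_cocycles HA.coboundaries_cocycles HA.class_repr(1)[OF assms(2) a']
      by auto
    note car = HM.cocycle_closed[OF assms(1)] HM.cocycle_closed[OF b'] HA.cocycle_closed[OF ca]
      HA.cocycle_closed[OF c'] HA.cocycle_closed[OF assms(2)]
    have "cohom_class M i (ract M m' a')
        = cohom_class M i (ract M b a') \<oplus>\<^bsub>cohom M i\<^esub> cohom_class M i (ract M m a')"
      using car b' ca assms unfolding b(2) by (simp add: ract_add_left HM.class_add ract_cocycle)
    also have "\<dots> = cohom_class M i (ract M m a')"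
      using assms ca by (simp add: HM.class_coboundary[OF ract_coboundary_left[OF b(1) ca]] ract_cocycle)
    also have "\<dots> = cohom_class M i (ract M m c) \<oplus>\<^bsub>cohom M i\<^esub> cohom_class M i (ract M m a)"
      using car c' assms unfolding c(2) by (simp add: ract_add_right HM.class_add ract_cocycle)
    also have "\<dots> = cohom_class M i (ract M m a)"
      using assms
      by (simp add: HM.class_coboundary[OF ract_coboundary_right[OF assms(1) c(1)]] ract_cocycle)
    finally show ?thesis .
  qed
  then show ?thesis
    using HM.class_self[OF assms(1)] HA.class_self[OF assms(2)] unfolding cohom_ract_def by blast
qed

end

context left_dg_module
begin

lemma lact_hom_left: "a \<in> carrier A \<Longrightarrow> abelian_group_hom N N (lact N a)"
  by (rule abelian_group_hom_intro) (auto simp: lact_closed lact_add_right N.abelian_group_axioms)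

lemma lact_hom_right: "n \<in> carrier N \<Longrightarrow> abelian_group_hom A N (\<lambda>a. lact N a n)"
  by (rule abelian_group_hom_intro)
    (auto simp: lact_closed lact_add_left N.abelian_group_axioms A.abelian_group_axioms)

lemma lact_zero [simp]:
  "a \<in> carrier A \<Longrightarrow> lact N a \<zero>\<^bsub>N\<^esub> = \<zero>\<^bsub>N\<^esub>" "n \<in> carrier N \<Longrightarrow> lact N \<zero>\<^bsub>A\<^esub> n = \<zero>\<^bsub>N\<^esub>"
  using abelian_group_hom.hom_zero[OF lact_hom_left] abelian_group_hom.hom_zero[OF lact_hom_right]
  by auto

lemma lact_cocycle:
  assumes "a \<in> cocycles A 0" "n \<in> cocycles N j"
  shows "lact N a n \<in> cocycles N j"
  using assms lact_degree[of a 0 n j] lact_leibniz[of a 0 n] A.gr_closed[of a] N.gr_closed[of n]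
  by (auto simp: cocycles_def)

lemma lact_coboundary_right:
  assumes "a \<in> cocycles A 0" "n \<in> coboundaries N j"
  shows "lact N a n \<in> coboundaries N j"
proof -
  obtain v where v: "v \<in> gr N (j - 1)" "n = diff N v"
    using assms(2) by (auto simp: coboundaries_def)
  have "lact N a v \<in> gr N (j - 1)" "diff N (lact N a v) = lact N a n"
    using assms(1) v lact_degree[of a 0 v "j - 1"] lact_leibniz[of a 0 v] A.gr_closed[of a]
      N.gr_closed[of v]
    by (auto simp: cocycles_def lact_closed N.diff_closed)
  then show ?thesis unfolding coboundaries_def by (metis imageI)
qed

lemma lact_coboundary_left:
  assumes "a \<in> coboundaries A 0" "n \<in> cocycles N j"
  shows "lact N a n \<in> coboundaries N j"
proof -
  obtain e where e: "e \<in> gr A (- 1)" "a = diff A e"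
    using assms(1) by (auto simp: coboundaries_def)
  have n: "n \<in> gr N j" "diff N n = \<zero>\<^bsub>N\<^esub>" using assms(2) by (auto simp: cocycles_def)
  note closed = N.gr_closed[OF n(1)] A.gr_closed[OF e(1)] A.diff_closed[OF A.gr_closed[OF e(1)]]
  have "diff N (lact N e n) = lact N a n"
    using lact_leibniz[OF e(1) closed(1)] n(2) closed e(2)
    by (simp add: lact_closed N.sgn_mult_zero)
  moreover have "lact N e n \<in> gr N (j - 1)"
    using lact_degree[OF e(1) n(1)] by (simp add: algebra_simps)
  ultimately show ?thesis unfolding coboundaries_def by (metis imageI)
qed

lemma cohom_lact_class:
  assumes "a \<in> cocycles A 0" "n \<in> cocycles N j"
  shows "cohom_lact N j (cohom_class A 0 a) (cohom_class N j n) = cohom_class N j (lact N a n)"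
proof -
  interpret HN: cohom_degree N j by (rule N.cohom_degree)
  interpret HA: cohom_degree A 0 by (rule A.cohom_degree)
  have "cohom_class N j (lact N a' n') = cohom_class N j (lact N a n)"
    if a': "a' \<in> cohom_class A 0 a" and n': "n' \<in> cohom_class N j n" for a' n'
  proof -
    obtain b where b: "b \<in> coboundaries N j" "n' = b \<oplus>\<^bsub>N\<^esub> n" using n' by (rule HN.class_memE)
    obtain c where c: "c \<in> coboundaries A 0" "a' = c \<oplus>\<^bsub>A\<^esub> a" using a' by (rule HA.class_memE)
    have b': "b \<in> cocycles N j" and c': "c \<in> cocycles A 0" and ca: "a' \<in> cocycles A 0"
      using b c HN.coboundaries_cocycles HA.coboundaries_cocycles HA.class_repr(1)[OF assms(1) a']
      by auto
    note car = HN.cocycle_closed[OF assms(2)] HN.cocycle_closed[OF b'] HA.cocycle_closed[OF ca]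
      HA.cocycle_closed[OF c'] HA.cocycle_closed[OF assms(1)]
    have "cohom_class N j (lact N a' n')
        = cohom_class N j (lact N a' b) \<oplus>\<^bsub>cohom N j\<^esub> cohom_class N j (lact N a' n)"
      using car b' ca assms unfolding b(2) by (simp add: lact_add_right HN.class_add lact_cocycle)
    also have "\<dots> = cohom_class N j (lact N a' n)"
      using assms ca by (simp add: HN.class_coboundary[OF lact_coboundary_right[OF ca b(1)]] lact_cocycle)
    also have "\<dots> = cohom_class N j (lact N c n) \<oplus>\<^bsub>cohom N j\<^esub> cohom_class N j (lact N a n)"
      using car c' assms unfolding c(2) by (simp add: lact_add_left HN.class_add lact_cocycle)
    also have "\<dots> = cohom_class N j (lact N a n)"
      using assms
      by (simp add: HN.class_coboundary[OF lact_coboundary_left[OF c(1) assms(2)]] lact_cocycle)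
    finally show ?thesis .
  qed
  then show ?thesis
    using HN.class_self[OF assms(2)] HA.class_self[OF assms(1)] unfolding cohom_lact_def by blast
qed

end


section \<open>The tensor product of DG modules\<close>

text \<open>A right and a left DG module over the same central DG ring. The prefix \<open>U\<close> refers to the
  tensor product as an abelian group, \<open>T\<close> to the DG \<open>K\<close>-module with the same underlying group.\<close>

locale dg_pair = R: central_dg_ring K A \<iota> + rm: right_dg_module A M + lm: left_dg_module A N
  for K :: "'k ring" and A :: "'a dg" and \<iota> :: "'k \<Rightarrow> 'a"
    and M :: "('a, 'm) right_dg" and N :: "('a, 'n) left_dg"
begin

abbreviation "T \<equiv> dg_tensor A \<iota> M N"

sublocale U: balanced_pair A M "ract M" N "lact N"
  by (intro balanced_pair.intro balanced_pair_axioms.intro rm.M.abelian_group_axioms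
      lm.N.abelian_group_axioms rm.ract_closed lm.lact_closed)

lemma dg_tensor_simps [simp]:
  "carrier T = carrier U.tens" "\<zero>\<^bsub>T\<^esub> = \<zero>\<^bsub>U.tens\<^esub>" "add T = add U.tens"
  by (simp_all add: dg_tensor_def Let_def)

lemma dg_pure [simp]: "dg_pure A M N = U.pure"
  by (simp add: dg_pure_def)

sublocale T: abelian_group T
  by (rule abelian_group_transfer[OF U.T.abelian_group_axioms]) simp_all

lemma a_inv_T [simp]: "a_inv T = a_inv U.tens"
  by (simp add: fun_eq_iff a_inv_def m_inv_def)

text \<open>The candidate for the differential on \<open>m \<otimes> n\<close>, and its compatibility with the balancing
  relation. This is an identity between biadditive expressions in \<open>m\<close> and \<open>a\<close>, so
  homogeneous \<open>m\<close> and \<open>a\<close> suffice.\<close>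

definition diff_pair :: "'m \<Rightarrow> 'n \<Rightarrow> ('m \<times> 'n \<Rightarrow>\<^sub>0 int) set" where
  "diff_pair m n = U.pure (diff M m) n \<oplus>\<^bsub>U.tens\<^esub> U.pure (sgn_twist M m) (diff N n)"

lemma diff_pair_add_left:
  "\<lbrakk>m \<in> carrier M; m' \<in> carrier M; n \<in> carrier N\<rbrakk>
    \<Longrightarrow> diff_pair (m \<oplus>\<^bsub>M\<^esub> m') n = diff_pair m n \<oplus>\<^bsub>U.tens\<^esub> diff_pair m' n"
  by (simp add: diff_pair_def rm.M.diff_closed lm.N.diff_closed rm.M.sgn_twist_closed
      rm.M.diff_add rm.M.sgn_twist_add U.pure_add_left U.T.a_ac)

lemma diff_pair_add_right:
  "\<lbrakk>m \<in> carrier M; n \<in> carrier N; n' \<in> carrier N\<rbrakk>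
    \<Longrightarrow> diff_pair m (n \<oplus>\<^bsub>N\<^esub> n') = diff_pair m n \<oplus>\<^bsub>U.tens\<^esub> diff_pair m n'"
  by (simp add: diff_pair_def rm.M.diff_closed lm.N.diff_closed rm.M.sgn_twist_closed
      lm.N.diff_add U.pure_add_right U.T.a_ac)

lemma diff_pair_balanced:
  assumes "m \<in> carrier M" "a \<in> carrier A" "n \<in> carrier N"
  shows "diff_pair (ract M m a) n = diff_pair m (lact N a n)"
proof -
  have on_homog: "diff_pair (ract M m a) n = diff_pair m (lact N a n)"
    if m: "m \<in> gr M i" and a: "a \<in> gr A j" and n: "n \<in> carrier N" for m i a j n
  proof -
    let ?p = "U.pure (ract M (diff M m) a) n"
    let ?q = "sgn_mult U.tens i (U.pure (ract M m (diff A a)) n)"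
    let ?r = "sgn_mult U.tens (i + j) (U.pure (ract M m a) (diff N n))"
    note car = rm.M.gr_closed[OF m] R.A.gr_closed[OF a] n rm.M.diff_closed[OF rm.M.gr_closed[OF m]]
      R.A.diff_closed[OF R.A.gr_closed[OF a]] lm.N.diff_closed[OF n]
    note cl = car rm.ract_closed lm.lact_closed rm.M.sgn_mult_closed lm.N.sgn_mult_closed
      U.T.sgn_mult_closed
    have "diff_pair (ract M m a) n = (?p \<oplus>\<^bsub>U.tens\<^esub> ?q) \<oplus>\<^bsub>U.tens\<^esub> ?r"
      by (simp add: diff_pair_def rm.ract_leibniz[OF m car(2)]
          rm.M.sgn_twist_homog[OF rm.ract_degree[OF m a]] U.pure_add_left U.pure_sgn_left cl)
    also have "\<dots> = ?p \<oplus>\<^bsub>U.tens\<^esub> (?q \<oplus>\<^bsub>U.tens\<^esub> ?r)"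
      by (simp add: U.T.a_assoc cl)
    also have "\<dots> = diff_pair m (lact N a n)"
      by (simp add: diff_pair_def lm.lact_leibniz[OF a n] rm.M.sgn_twist_homog[OF m]
          U.pure_add_right U.pure_sgn_left U.pure_sgn_right U.pure_balanced cl
          U.T.sgn_mult_add U.T.sgn_mult_sgn_mult add.commute[of j i])
    finally show ?thesis .
  qed
  have "diff_pair (ract M m a) n = diff_pair m (lact N a n)"
    if m: "m \<in> gr M i" for m i
    using assms(2)
  proof (induction a rule: R.A.homog_induct)
    case (homog j a)
    then show ?case using m assms(3) by (intro on_homog)
  next
    case (add a b)
    then show ?case
      using assms(3) rm.M.gr_closed[OF m]
      by (simp add: rm.ract_add_right lm.lact_add_left diff_pair_add_left diff_pair_add_right
          rm.ract_closed lm.lact_closed)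
  qed
  note gr = this
  show ?thesis
    using assms(1)
  proof (induction m rule: rm.M.homog_induct)
    case (homog i m)
    then show ?case by (rule gr)
  next
    case (add m m')
    then show ?case
      using assms(2,3)
      by (simp add: rm.ract_add_left diff_pair_add_left rm.ract_closed lm.lact_closed)
  qed
qed

lemma diff_T_hom: "abelian_group_hom U.tens U.tens (diff T)"
  and diff_T_pure: "\<And>m n. \<lbrakk>m \<in> carrier M; n \<in> carrier N\<rbrakk> \<Longrightarrow> diff T (U.pure m n) = diff_pair m n"
proof -
  let ?g = "\<lambda>(m, n). frag_of (diff M m, n) + frag_of (sgn_twist M m, diff N n)"
  have pair: "balanced_pair A M (ract M) N (lact N)" by (rule U.balanced_pair_axioms)
  have keys: "Poly_Mapping.keys (?g (m, n)) \<subseteq> U.pairs" if "m \<in> carrier M" "n \<in> carrier N" for m n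
    using that keys_add[of "frag_of (diff M m, n)" "frag_of (sgn_twist M m, diff N n)"]
    by (auto simp: rm.M.diff_closed lm.N.diff_closed rm.M.sgn_twist_closed)
  have cls: "U.cls (?g (m, n)) = diff_pair m n" if "m \<in> carrier M" "n \<in> carrier N" for m n
    using that by (simp add: U.cls_add diff_pair_def pure_tensor_def rm.M.diff_closed
        lm.N.diff_closed rm.M.sgn_twist_closed)
  have diff: "diff T = tensor_lift A M (ract M) N (lact N) ?g"
    by (simp add: dg_tensor_def Let_def)
  note lift = tensor_lift_hom[OF pair pair, of ?g, folded diff, OF keys]
  show "abelian_group_hom U.tens U.tens (diff T)"
    by (rule lift(1)) (simp_all only: cls diff_pair_add_left diff_pair_add_right diff_pair_balanced
        rm.ract_closed lm.lact_closed rm.M.a_closed lm.N.a_closed)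
  show "diff T (U.pure m n) = diff_pair m n" if "m \<in> carrier M" "n \<in> carrier N" for m n
  proof -
    have "diff T (U.pure m n) = U.cls (?g (m, n))"
      by (rule lift(2)) (simp_all only: that cls diff_pair_add_left diff_pair_add_right
          diff_pair_balanced rm.ract_closed lm.lact_closed rm.M.a_closed lm.N.a_closed)
    then show ?thesis using that by (simp only: cls)
  qed
qed

lemma gr_T: "gr T k = generate (add_monoid U.tens)
    {U.pure m n | m n i j. m \<in> gr M i \<and> n \<in> gr N j \<and> i + j = k}"
  by (simp add: dg_tensor_def Let_def)

lemma gr_T_subgroup: "additive_subgroup (gr T k) U.tens"
  unfolding gr_T
  by (rule additive_subgroupI, rule U.T.add.generate_is_subgroup)
    (auto intro!: U.pure_closed intro: rm.M.gr_closed lm.N.gr_closed)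

lemma gr_T_closed: "t \<in> gr T k \<Longrightarrow> t \<in> carrier U.tens"
  using additive_subgroup.a_subset[OF gr_T_subgroup] by blast

lemma pure_gr_T: "\<lbrakk>m \<in> gr M i; n \<in> gr N j; i + j = k\<rbrakk> \<Longrightarrow> U.pure m n \<in> gr T k"
  unfolding gr_T by (rule generate.incl) blast

text \<open>Again \<open>- (m \<otimes> n) = (- m) \<otimes> n\<close>, so no case for negatives is needed.\<close>

lemma gr_T_induct [consumes 1, case_names zero pure add]:
  assumes "t \<in> gr T k"
    and zero: "Z \<zero>\<^bsub>U.tens\<^esub>"
    and pure: "\<And>m n i j. \<lbrakk>m \<in> gr M i; n \<in> gr N j; i + j = k\<rbrakk> \<Longrightarrow> Z (U.pure m n)"
    and add: "\<And>s t. \<lbrakk>s \<in> gr T k; t \<in> gr T k; Z s; Z t\<rbrakk> \<Longrightarrow> Z (s \<oplus>\<^bsub>U.tens\<^esub> t)"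
  shows "Z t"
  using assms(1) unfolding gr_T
proof (induction rule: generate.induct)
  case one
  then show ?case using zero by simp
next
  case (incl h)
  then show ?case using pure by blast
next
  case (inv h)
  then obtain m n i j where h: "h = U.pure m n" "m \<in> gr M i" "n \<in> gr N j" "i + j = k" by blast
  then have "inv\<^bsub>add_monoid U.tens\<^esub> h = U.pure (\<ominus>\<^bsub>M\<^esub> m) n"
    using U.pure_minus_left[of m n] by (simp add: a_inv_def rm.M.gr_closed lm.N.gr_closed)
  then show ?case using pure[OF rm.M.minus_gr[OF h(2)] h(3,4)] by simp
next
  case (eng h1 h2)
  then show ?case using add[of h1 h2] unfolding gr_T by simp
qed

lemma diff_T_degree:
  assumes "t \<in> gr T k"
  shows "diff T t \<in> gr T (k + 1)"
  using assms
proof (induction t rule: gr_T_induct)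
  case zero
  then show ?case
    using abelian_group_hom.hom_zero[OF diff_T_hom] additive_subgroup.zero_closed[OF gr_T_subgroup]
    by simp
next
  case (pure m n i j)
  have "diff T (U.pure m n)
      = U.pure (diff M m) n \<oplus>\<^bsub>U.tens\<^esub> U.pure (sgn_twist M m) (diff N n)"
    using pure rm.M.gr_closed lm.N.gr_closed by (simp add: diff_T_pure diff_pair_def)
  moreover have "U.pure (diff M m) n \<in> gr T (k + 1)"
    using pure by (intro pure_gr_T[OF rm.M.diff_degree]) auto
  moreover have "U.pure (sgn_twist M m) (diff N n) \<in> gr T (k + 1)"
    using pure by (intro pure_gr_T[OF rm.M.sgn_twist_gr lm.N.diff_degree]) auto
  ultimately show ?case
    using additive_subgroup.a_closed[OF gr_T_subgroup] by simp
next
  case (add s t)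
  then show ?case
    using additive_subgroup.a_closed[OF gr_T_subgroup] abelian_group_hom.hom_add[OF diff_T_hom]
    by (simp add: gr_T_closed)
qed

text \<open>The scalars act on \<open>M\<close> through \<open>\<iota>\<close>. The third and the fifth law use that \<open>\<iota> k\<close> is
  central.\<close>

lemma iota_closed [simp]: "k \<in> carrier K \<Longrightarrow> \<iota> k \<in> carrier A"
  by (rule ring_hom_closed[OF R.struct_hom])

lemma ract_iota_gr: "\<lbrakk>m \<in> gr M i; k \<in> carrier K\<rbrakk> \<Longrightarrow> ract M m (\<iota> k) \<in> gr M i"
  using rm.ract_degree[of m i "\<iota> k" 0] R.struct_degree by simp

lemma scalar_axioms:
  "\<And>k m. \<lbrakk>k \<in> carrier K; m \<in> carrier M\<rbrakk> \<Longrightarrow> ract M m (\<iota> k) \<in> carrier M"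
  "\<And>k m m'. \<lbrakk>k \<in> carrier K; m \<in> carrier M; m' \<in> carrier M\<rbrakk>
    \<Longrightarrow> ract M (m \<oplus>\<^bsub>M\<^esub> m') (\<iota> k) = ract M m (\<iota> k) \<oplus>\<^bsub>M\<^esub> ract M m' (\<iota> k)"
  "\<And>k m a. \<lbrakk>k \<in> carrier K; m \<in> carrier M; a \<in> carrier A\<rbrakk>
    \<Longrightarrow> ract M (ract M m a) (\<iota> k) = ract M (ract M m (\<iota> k)) a"
  "\<And>k l m. \<lbrakk>k \<in> carrier K; l \<in> carrier K; m \<in> carrier M\<rbrakk>
    \<Longrightarrow> ract M m (\<iota> (k \<oplus>\<^bsub>K\<^esub> l)) = ract M m (\<iota> k) \<oplus>\<^bsub>M\<^esub> ract M m (\<iota> l)"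
  "\<And>k l m. \<lbrakk>k \<in> carrier K; l \<in> carrier K; m \<in> carrier M\<rbrakk>
    \<Longrightarrow> ract M m (\<iota> (k \<otimes>\<^bsub>K\<^esub> l)) = ract M (ract M m (\<iota> l)) (\<iota> k)"
  "\<And>m. m \<in> carrier M \<Longrightarrow> ract M m (\<iota> \<one>\<^bsub>K\<^esub>) = m"
proof -
  show "ract M (ract M m a) (\<iota> k) = ract M (ract M m (\<iota> k)) a"
    if "k \<in> carrier K" "m \<in> carrier M" "a \<in> carrier A" for k m a
    using that R.struct_central[of k a] by (simp flip: rm.ract_assoc)
  show "ract M m (\<iota> (k \<otimes>\<^bsub>K\<^esub> l)) = ract M (ract M m (\<iota> l)) (\<iota> k)"
    if "k \<in> carrier K" "l \<in> carrier K" "m \<in> carrier M" for k l m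
    using that R.struct_central[of k "\<iota> l"]
    by (simp add: ring_hom_mult[OF R.struct_hom] flip: rm.ract_assoc)
qed (simp_all add: rm.ract_closed rm.ract_add_left rm.ract_add_right rm.ract_one
      ring_hom_add[OF R.struct_hom] ring_hom_one[OF R.struct_hom])

lemma lact_T: "lact T k = tensor_map A M (ract M) N (lact N) (\<lambda>m. ract M m (\<iota> k)) id"
  by (simp add: dg_tensor_def Let_def)

lemma lact_T_hom: "k \<in> carrier K \<Longrightarrow> abelian_group_hom U.tens U.tens (lact T k)"
  unfolding lact_T
  by (rule U.smult_tensor_hom(1)[where s = "\<lambda>k m. ract M m (\<iota> k)", OF R.K.is_cring scalar_axioms])

lemma lact_T_pure:
  "\<lbrakk>k \<in> carrier K; m \<in> carrier M; n \<in> carrier N\<rbrakk>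
    \<Longrightarrow> lact T k (U.pure m n) = U.pure (ract M m (\<iota> k)) n"
  unfolding lact_T
  by (rule U.smult_tensor_hom(2)[where s = "\<lambda>k m. ract M m (\<iota> k)", OF R.K.is_cring scalar_axioms])

text \<open>The module laws hold on the whole tensor product; those on its cohomology are read off on
  representatives.\<close>

lemma lact_T_module: "module K (ring.extend U.tens (module.fields (lact T)))"
  using U.tensor_module[where s = "\<lambda>k m. ract M m (\<iota> k)", OF R.K.is_cring scalar_axioms]
  unfolding lact_T[abs_def] .

lemma lact_T_gr:
  assumes "k \<in> carrier K" "t \<in> gr T l"
  shows "lact T k t \<in> gr T l"
  using assms(2)
proof (induction t rule: gr_T_induct)
  case zero
  then show ?case
    using abelian_group_hom.hom_zero[OF lact_T_hom[OF assms(1)]]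
      additive_subgroup.zero_closed[OF gr_T_subgroup] by simp
next
  case (pure m n i j)
  then show ?case
    using assms(1) pure_gr_T[OF ract_iota_gr[OF pure(1) assms(1)] pure(2,3)]
    by (simp add: lact_T_pure rm.M.gr_closed lm.N.gr_closed)
next
  case (add s t)
  then show ?case
    using additive_subgroup.a_closed[OF gr_T_subgroup]
      abelian_group_hom.hom_add[OF lact_T_hom[OF assms(1)]]
    by (simp add: gr_T_closed)
qed

lemma ract_iota_diff:
  assumes "k \<in> carrier K" "m \<in> carrier M"
  shows "diff M (ract M m (\<iota> k)) = ract M (diff M m) (\<iota> k)"
  using assms(2)
proof (induction m rule: rm.M.homog_induct)
  case (homog i m)
  then show ?case
    using assms(1) rm.M.gr_closed[OF homog] rm.ract_leibniz[OF homog, of "\<iota> k"] R.struct_cocycle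
    by (simp add: rm.ract_closed rm.M.diff_closed rm.M.sgn_mult_zero)
next
  case (add m m')
  then show ?case
    using assms(1) by (simp add: rm.ract_add_left rm.M.diff_add rm.ract_closed rm.M.diff_closed)
qed

lemma lact_T_diff:
  assumes k: "k \<in> carrier K" and "t \<in> gr T l"
  shows "diff T (lact T k t) = lact T k (diff T t)"
  using assms(2)
proof (induction t rule: gr_T_induct)
  case zero
  then show ?case
    using abelian_group_hom.hom_zero[OF lact_T_hom[OF k]] abelian_group_hom.hom_zero[OF diff_T_hom]
    by simp
next
  case (pure m n i j)
  note m = rm.M.gr_closed[OF pure(1)] and n = lm.N.gr_closed[OF pure(2)]
  have "sgn_twist M (ract M m (\<iota> k)) = ract M (sgn_twist M m) (\<iota> k)"
    using abelian_group_hom.hom_sgn_mult[OF rm.ract_hom_left[OF iota_closed[OF k]] m]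
    by (simp add: rm.M.sgn_twist_homog[OF pure(1)]
        rm.M.sgn_twist_homog[OF ract_iota_gr[OF pure(1) k]])
  then show ?case
    using k m n
    by (simp add: lact_T_pure diff_T_pure diff_pair_def rm.ract_closed ract_iota_diff
        abelian_group_hom.hom_add[OF lact_T_hom[OF k]]
        rm.M.diff_closed lm.N.diff_closed rm.M.sgn_twist_closed)
next
  case (add s t)
  then show ?case
    using gr_T_closed k abelian_group_hom.hom_closed[OF lact_T_hom[OF k]]
      abelian_group_hom.hom_closed[OF diff_T_hom]
    by (simp add: abelian_group_hom.hom_add[OF lact_T_hom[OF k]]
        abelian_group_hom.hom_add[OF diff_T_hom])
qed

end


section \<open>The comparison map in top degree\<close>

text \<open>The degree bounds of the theorem. The prefix \<open>C\<close> refers to the tensor product of the top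
  cohomologies over \<open>H\<^sup>0(A)\<close>, and \<open>tdeg\<close> is the top degree of the tensor product of DG modules.\<close>

locale dg_pair_top = dg_pair +
  fixes i0 j0 :: int
  assumes nonpos: "nonpositive A" and conc_M: "concentrated_le M i0" and conc_N: "concentrated_le N j0"
begin

abbreviation "tdeg \<equiv> i0 + j0"

lemma gr_A_pos: "i > 0 \<Longrightarrow> gr A i = {\<zero>\<^bsub>A\<^esub>}"
  using nonpos by (simp add: nonpositive_def concentrated_le_def)

lemma gr_M_above: "i > i0 \<Longrightarrow> gr M i = {\<zero>\<^bsub>M\<^esub>}"
  using conc_M by (simp add: concentrated_le_def)

lemma gr_N_above: "j > j0 \<Longrightarrow> gr N j = {\<zero>\<^bsub>N\<^esub>}"
  using conc_N by (simp add: concentrated_le_def)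

lemma cocycles_A: "cocycles A 0 = gr A 0"
  using R.A.diff_degree[of _ 0] gr_A_pos[of 1] by (auto simp: cocycles_def)

lemma cocycles_M: "cocycles M i0 = gr M i0"
  using rm.M.diff_degree[of _ i0] gr_M_above[of "i0 + 1"] by (auto simp: cocycles_def)

lemma cocycles_N: "cocycles N j0 = gr N j0"
  using lm.N.diff_degree[of _ j0] gr_N_above[of "j0 + 1"] by (auto simp: cocycles_def)

lemma gr_T_above:
  assumes "t \<in> gr T k" "k > tdeg"
  shows "t = \<zero>\<^bsub>U.tens\<^esub>"
  using assms(1)
proof (induction t rule: gr_T_induct)
  case (pure m n i j)
  then have "i > i0 \<or> j > j0" using assms(2) by linarith
  then show ?case
    using pure gr_M_above gr_N_above rm.M.gr_closed lm.N.gr_closed by auto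
qed auto

lemma cocycles_T: "cocycles T tdeg = gr T tdeg"
  using diff_T_degree[of _ tdeg] gr_T_above[of _ "tdeg + 1"] by (auto simp: cocycles_def)

sublocale HA: cohom_degree A 0 by (rule R.A.cohom_degree)
sublocale HM: cohom_degree M i0 by (rule rm.M.cohom_degree)
sublocale HN: cohom_degree N j0 by (rule lm.N.cohom_degree)

text \<open>In top degree every element is a cocycle, so that \<open>d \<circ> d = 0\<close> on the tensor product is not
  needed for the inclusion of the coboundaries.\<close>

sublocale HT: cohom_degree T tdeg
proof (intro cohom_degree.intro cohom_degree_axioms.intro)
  show "abelian_group T" by (rule T.abelian_group_axioms)
  show "additive_subgroup (cocycles T tdeg) T"
    unfolding cocycles_T
  proof (rule additive_subgroupI, rule T.add.subgroupI)
    show "gr T tdeg \<noteq> {}"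
      using additive_subgroup.zero_closed[OF gr_T_subgroup] by blast
  qed (use gr_T_closed additive_subgroup.a_closed[OF gr_T_subgroup]
      additive_subgroup.a_inv_closed[OF gr_T_subgroup] in auto)
  show "additive_subgroup (coboundaries T tdeg) T"
    unfolding coboundaries_def
  proof (rule additive_subgroupI, rule T.add.subgroupI)
    show "diff T ` gr T (tdeg - 1) \<subseteq> carrier T"
      using gr_T_closed abelian_group_hom.hom_closed[OF diff_T_hom] by auto
    show "diff T ` gr T (tdeg - 1) \<noteq> {}"
      using additive_subgroup.zero_closed[OF gr_T_subgroup] by blast
    fix x assume "x \<in> diff T ` gr T (tdeg - 1)"
    then obtain u where u: "u \<in> gr T (tdeg - 1)" "x = diff T u" by blast
    have "x = diff T u" "\<ominus>\<^bsub>T\<^esub> x = diff T (\<ominus>\<^bsub>U.tens\<^esub> u)"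
      using u abelian_group_hom.hom_a_inv[OF diff_T_hom] gr_T_closed by auto
    then show "\<ominus>\<^bsub>T\<^esub> x \<in> diff T ` gr T (tdeg - 1)"
      using additive_subgroup.a_inv_closed[OF gr_T_subgroup u(1)] by blast
    fix y assume "y \<in> diff T ` gr T (tdeg - 1)"
    then obtain v where v: "v \<in> gr T (tdeg - 1)" "y = diff T v" by blast
    have "x \<oplus>\<^bsub>T\<^esub> y = diff T (u \<oplus>\<^bsub>U.tens\<^esub> v)"
      using u v abelian_group_hom.hom_add[OF diff_T_hom] gr_T_closed by auto
    then show "x \<oplus>\<^bsub>T\<^esub> y \<in> diff T ` gr T (tdeg - 1)"
      using additive_subgroup.a_closed[OF gr_T_subgroup u(1) v(1)] by blast
  qed
  show "coboundaries T tdeg \<subseteq> cocycles T tdeg"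
    unfolding cocycles_T coboundaries_def using diff_T_degree[of _ "tdeg - 1"] by auto
qed

lemma ract_class:
  "\<lbrakk>m \<in> gr M i0; a \<in> gr A 0\<rbrakk>
    \<Longrightarrow> cohom_ract M i0 (cohom_class M i0 m) (cohom_class A 0 a) = cohom_class M i0 (ract M m a)"
  using rm.cohom_ract_class by (simp add: cocycles_M cocycles_A)

lemma lact_class:
  "\<lbrakk>a \<in> gr A 0; n \<in> gr N j0\<rbrakk>
    \<Longrightarrow> cohom_lact N j0 (cohom_class A 0 a) (cohom_class N j0 n) = cohom_class N j0 (lact N a n)"
  using lm.cohom_lact_class by (simp add: cocycles_N cocycles_A)

lemma ract_gr: "\<lbrakk>m \<in> gr M i0; a \<in> gr A 0\<rbrakk> \<Longrightarrow> ract M m a \<in> gr M i0"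
  using rm.ract_degree[of m i0 a 0] by simp

lemma lact_gr: "\<lbrakk>a \<in> gr A 0; n \<in> gr N j0\<rbrakk> \<Longrightarrow> lact N a n \<in> gr N j0"
  using lm.lact_degree[of a 0 n j0] by simp

lemmas class_reprs = HM.carrier_cohom[unfolded cocycles_M] HN.carrier_cohom[unfolded cocycles_N]
  HA.carrier_cohom[unfolded cocycles_A] HT.carrier_cohom[unfolded cocycles_T]

sublocale C: balanced_pair "cohom A 0" "cohom M i0" "cohom_ract M i0" "cohom N j0" "cohom_lact N j0"
  by (intro balanced_pair.intro balanced_pair_axioms.intro HM.H.abelian_group_axioms
      HN.H.abelian_group_axioms)
    (auto simp: class_reprs ract_class lact_class ract_gr lact_gr)

lemma pure_coboundary_left:
  assumes "b \<in> coboundaries M i0" "n \<in> gr N j0"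
  shows "U.pure b n \<in> coboundaries T tdeg"
proof -
  obtain u where u: "u \<in> gr M (i0 - 1)" "b = diff M u" using assms(1) by (auto simp: coboundaries_def)
  have "diff N n = \<zero>\<^bsub>N\<^esub>" using assms(2) cocycles_N by (auto simp: cocycles_def)
  then have "diff T (U.pure u n) = U.pure b n"
    using u assms(2) rm.M.gr_closed lm.N.gr_closed rm.M.diff_closed
    by (simp add: diff_T_pure diff_pair_def rm.M.sgn_twist_closed)
  moreover have "U.pure u n \<in> gr T (tdeg - 1)"
    by (rule pure_gr_T[OF u(1) assms(2)]) simp
  ultimately show ?thesis unfolding coboundaries_def by (metis imageI)
qed

lemma pure_coboundary_right:
  assumes "m \<in> gr M i0" "c \<in> coboundaries N j0"
  shows "U.pure m c \<in> coboundaries T tdeg"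
proof -
  obtain v where v: "v \<in> gr N (j0 - 1)" "c = diff N v" using assms(2) by (auto simp: coboundaries_def)
  \<comment> \<open>The sign on \<open>m\<close> cancels the Koszul sign, as \<open>d(m \<otimes> v) = (-1)\<^sup>i m \<otimes> dv\<close> for a cocycle \<open>m\<close> of
    degree \<open>i\<close>.\<close>
  let ?m = "sgn_mult M i0 m"
  have gr: "?m \<in> gr M i0" by (rule rm.M.sgn_mult_gr[OF assms(1)])
  then have "diff M ?m = \<zero>\<^bsub>M\<^esub>" using cocycles_M by (auto simp: cocycles_def)
  moreover have "sgn_twist M ?m = m"
    using assms(1) by (simp add: rm.M.sgn_twist_homog[OF gr] rm.M.sgn_mult_sgn_mult rm.M.gr_closed)
      (simp add: sgn_mult_def)
  ultimately have "diff T (U.pure ?m v) = U.pure m c"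
    using v assms(1) gr rm.M.gr_closed lm.N.gr_closed lm.N.diff_closed
    by (simp add: diff_T_pure diff_pair_def)
  moreover have "U.pure ?m v \<in> gr T (tdeg - 1)"
    by (rule pure_gr_T[OF gr v(1)]) simp
  ultimately show ?thesis unfolding coboundaries_def by (metis imageI)
qed

lemma class_T_add:
  "\<lbrakk>s \<in> gr T tdeg; t \<in> gr T tdeg\<rbrakk> \<Longrightarrow> cohom_class T tdeg (s \<oplus>\<^bsub>U.tens\<^esub> t)
    = cohom_class T tdeg s \<oplus>\<^bsub>cohom T tdeg\<^esub> cohom_class T tdeg t"
  using HT.class_add by (simp add: cocycles_T)

lemma class_pure_cong:
  assumes m: "m \<in> gr M i0" and n: "n \<in> gr N j0"
    and m': "m' \<in> cohom_class M i0 m" and n': "n' \<in> cohom_class N j0 n"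
  shows "cohom_class T tdeg (U.pure m' n') = cohom_class T tdeg (U.pure m n)"
proof -
  obtain b where b: "b \<in> coboundaries M i0" "m' = b \<oplus>\<^bsub>M\<^esub> m" using m' by (rule HM.class_memE)
  obtain c where c: "c \<in> coboundaries N j0" "n' = c \<oplus>\<^bsub>N\<^esub> n" using n' by (rule HN.class_memE)
  have gr: "b \<in> gr M i0" "c \<in> gr N j0" "n' \<in> gr N j0"
    using b c n HM.coboundaries_cocycles HN.coboundaries_cocycles lm.N.add_gr
    by (auto simp: cocycles_M cocycles_N)
  note car = rm.M.gr_closed[OF m] rm.M.gr_closed[OF gr(1)] lm.N.gr_closed[OF n]
    lm.N.gr_closed[OF gr(2)] lm.N.gr_closed[OF gr(3)]
  have "cohom_class T tdeg (U.pure m' n')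
      = cohom_class T tdeg (U.pure b n') \<oplus>\<^bsub>cohom T tdeg\<^esub> cohom_class T tdeg (U.pure m n')"
    using car gr m unfolding b(2) by (simp add: U.pure_add_left class_T_add pure_gr_T)
  also have "\<dots> = cohom_class T tdeg (U.pure m n')"
    using HT.class_coboundary[OF pure_coboundary_left[OF b(1) gr(3)]] m gr
    by (simp add: class_reprs pure_gr_T)
  also have "\<dots> = cohom_class T tdeg (U.pure m c) \<oplus>\<^bsub>cohom T tdeg\<^esub> cohom_class T tdeg (U.pure m n)"
    using car gr m n unfolding c(2) by (simp add: U.pure_add_right class_T_add pure_gr_T)
  also have "\<dots> = cohom_class T tdeg (U.pure m n)"
    using HT.class_coboundary[OF pure_coboundary_right[OF m c(1)]] m n
    by (simp add: class_reprs pure_gr_T)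
  finally show ?thesis .
qed

lemma theta_hom_exists:
  obtains \<theta> where "abelian_group_hom C.tens (cohom T tdeg) \<theta>"
    "\<And>m n. \<lbrakk>m \<in> gr M i0; n \<in> gr N j0\<rbrakk>
      \<Longrightarrow> \<theta> (C.pure (cohom_class M i0 m) (cohom_class N j0 n)) = cohom_class T tdeg (U.pure m n)"
proof -
  \<comment> \<open>Any representatives may be chosen, by \<open>class_pure_cong\<close>.\<close>
  define \<beta> where "\<beta> X Y = cohom_class T tdeg (U.pure (SOME m. m \<in> X) (SOME n. n \<in> Y))" for X Y
  have \<beta>: "\<beta> (cohom_class M i0 m) (cohom_class N j0 n) = cohom_class T tdeg (U.pure m n)"
    if mn: "m \<in> gr M i0" "n \<in> gr N j0" for m n
  proof -
    have "(SOME x. x \<in> cohom_class M i0 m) \<in> cohom_class M i0 m"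
      using HM.class_self[unfolded cocycles_M, OF mn(1)] by (rule someI)
    moreover have "(SOME y. y \<in> cohom_class N j0 n) \<in> cohom_class N j0 n"
      using HN.class_self[unfolded cocycles_N, OF mn(2)] by (rule someI)
    ultimately show ?thesis unfolding \<beta>_def by (rule class_pure_cong[OF mn])
  qed
  have add_M: "cohom_class M i0 m \<oplus>\<^bsub>cohom M i0\<^esub> cohom_class M i0 m' = cohom_class M i0 (m \<oplus>\<^bsub>M\<^esub> m')"
    if "m \<in> gr M i0" "m' \<in> gr M i0" for m m'
    using that HM.class_add cocycles_M by simp
  have add_N: "cohom_class N j0 n \<oplus>\<^bsub>cohom N j0\<^esub> cohom_class N j0 n' = cohom_class N j0 (n \<oplus>\<^bsub>N\<^esub> n')"
    if "n \<in> gr N j0" "n' \<in> gr N j0" for n n'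
    using that HN.class_add cocycles_N by simp
  obtain \<theta> where \<theta>: "abelian_group_hom C.tens (cohom T tdeg) \<theta>"
    and on_pure: "\<And>X Y. \<lbrakk>X \<in> carrier (cohom M i0); Y \<in> carrier (cohom N j0)\<rbrakk> \<Longrightarrow> \<theta> (C.pure X Y) = \<beta> X Y"
  proof (rule C.tensor_universal[OF HT.H.abelian_group_axioms, of \<beta>])
    fix X Y assume "X \<in> carrier (cohom M i0)" "Y \<in> carrier (cohom N j0)"
    then obtain m n where mn: "m \<in> gr M i0" "X = cohom_class M i0 m"
      "n \<in> gr N j0" "Y = cohom_class N j0 n" by (auto simp: class_reprs)
    then show "\<beta> X Y \<in> carrier (cohom T tdeg)"
      by (auto simp: \<beta> class_reprs pure_gr_T)
    show "\<beta> (X \<oplus>\<^bsub>cohom M i0\<^esub> X') Y = \<beta> X Y \<oplus>\<^bsub>cohom T tdeg\<^esub> \<beta> X' Y"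
      if X': "X' \<in> carrier (cohom M i0)" for X'
    proof -
      obtain m' where "m' \<in> gr M i0" "X' = cohom_class M i0 m'" using X' by (auto simp: class_reprs)
      then show ?thesis
        using mn rm.M.gr_closed lm.N.gr_closed
        by (simp add: add_M \<beta> rm.M.add_gr U.pure_add_left class_T_add pure_gr_T)
    qed
    show "\<beta> X (Y \<oplus>\<^bsub>cohom N j0\<^esub> Y') = \<beta> X Y \<oplus>\<^bsub>cohom T tdeg\<^esub> \<beta> X Y'"
      if Y': "Y' \<in> carrier (cohom N j0)" for Y'
    proof -
      obtain n' where "n' \<in> gr N j0" "Y' = cohom_class N j0 n'" using Y' by (auto simp: class_reprs)
      then show ?thesis
        using mn rm.M.gr_closed lm.N.gr_closed
        by (simp add: add_N \<beta> lm.N.add_gr U.pure_add_right class_T_add pure_gr_T)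
    qed
    show "\<beta> (cohom_ract M i0 X r) Y = \<beta> X (cohom_lact N j0 r Y)" if r: "r \<in> carrier (cohom A 0)" for r
    proof -
      obtain a where "a \<in> gr A 0" "r = cohom_class A 0 a" using r by (auto simp: class_reprs)
      then show ?thesis
        using mn rm.M.gr_closed lm.N.gr_closed R.A.gr_closed
        by (simp add: ract_class lact_class \<beta> ract_gr lact_gr U.pure_balanced)
    qed
  qed blast
  show ?thesis
    by (rule that[OF \<theta>]) (auto simp: on_pure class_reprs \<beta>)
qed

text \<open>By the degree bounds, a product of homogeneous elements \<open>m\<close> and \<open>a\<close> that has degree \<open>i\<^sub>0\<close> vanishes
  unless \<open>m\<close> has degree \<open>i\<^sub>0\<close> and \<open>a\<close> has degree \<open>0\<close>.\<close>

lemma homog_part_ract: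
  assumes "m \<in> carrier M" "a \<in> carrier A"
  shows "homog_part M (ract M m a) i0 = ract M (homog_part M m i0) (homog_part A a 0)"
proof -
  have on_homog: "homog_part M (ract M m a) i0 = ract M (homog_part M m i0) (homog_part A a 0)"
    if m: "m \<in> gr M i" and a: "a \<in> gr A j" for m i a j
  proof -
    note car = rm.M.gr_closed[OF m] R.A.gr_closed[OF a]
    consider "i = i0" "j = 0" | "i > i0" | "j > 0" | "i + j < i0" by linarith
    then show ?thesis
    proof cases
      case 4
      then show ?thesis
        using m a car by (auto simp: rm.M.homog_part_homog[OF rm.ract_degree[OF m a]]
            rm.M.homog_part_homog[OF m] R.A.homog_part_homog[OF a])
    qed (use m a car gr_M_above[of i] gr_A_pos[of j] in
        \<open>auto simp: rm.M.homog_part_homog[OF rm.ract_degree[OF m a]]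
            rm.M.homog_part_homog[OF m] R.A.homog_part_homog[OF a]\<close>)
  qed
  have gr: "homog_part M (ract M m a) i0 = ract M (homog_part M m i0) (homog_part A a 0)"
    if m: "m \<in> gr M i" for m i
    using assms(2)
  proof (induction a rule: R.A.homog_induct)
    case (homog j a)
    then show ?case using m by (intro on_homog)
  next
    case (add a b)
    then show ?case
      using rm.M.gr_closed[OF m]
      by (simp add: rm.ract_add_right rm.M.homog_part_add R.A.homog_part_add rm.ract_closed
          rm.M.homog_part_closed R.A.homog_part_closed)
  qed
  show ?thesis
    using assms(1)
  proof (induction m rule: rm.M.homog_induct)
    case (homog i m)
    then show ?case by (rule gr)
  next
    case (add m m')
    then show ?case
      using assms(2)
      by (simp add: rm.ract_add_left rm.M.homog_part_add rm.ract_closed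
          rm.M.homog_part_closed R.A.homog_part_closed)
  qed
qed

lemma homog_part_lact:
  assumes "a \<in> carrier A" "n \<in> carrier N"
  shows "homog_part N (lact N a n) j0 = lact N (homog_part A a 0) (homog_part N n j0)"
proof -
  have on_homog: "homog_part N (lact N a n) j0 = lact N (homog_part A a 0) (homog_part N n j0)"
    if a: "a \<in> gr A i" and n: "n \<in> gr N j" for n i a j
  proof -
    note car = lm.N.gr_closed[OF n] R.A.gr_closed[OF a]
    consider "i = 0" "j = j0" | "i > 0" | "j > j0" | "i + j < j0" by linarith
    then show ?thesis
    proof cases
      case 4
      then show ?thesis
        using n a car by (auto simp: lm.N.homog_part_homog[OF lm.lact_degree[OF a n]]
            lm.N.homog_part_homog[OF n] R.A.homog_part_homog[OF a])
    qed (use n a car gr_N_above[of j] gr_A_pos[of i] in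
        \<open>auto simp: lm.N.homog_part_homog[OF lm.lact_degree[OF a n]]
            lm.N.homog_part_homog[OF n] R.A.homog_part_homog[OF a]\<close>)
  qed
  have gr: "homog_part N (lact N a n) j0 = lact N (homog_part A a 0) (homog_part N n j0)"
    if n: "n \<in> gr N j" for n j
    using assms(1)
  proof (induction a rule: R.A.homog_induct)
    case (homog i a)
    then show ?case using n by (intro on_homog)
  next
    case (add a b)
    then show ?case
      using lm.N.gr_closed[OF n]
      by (simp add: lm.lact_add_left lm.N.homog_part_add R.A.homog_part_add lm.lact_closed
          lm.N.homog_part_closed R.A.homog_part_closed)
  qed
  show ?thesis
    using assms(2)
  proof (induction n rule: lm.N.homog_induct)
    case (homog j n)
    then show ?case by (rule gr)
  next
    case (add n n')
    then show ?case
      using assms(1)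
      by (simp add: lm.lact_add_right lm.N.homog_part_add lm.lact_closed
          lm.N.homog_part_closed R.A.homog_part_closed)
  qed
qed

text \<open>The left inverse of \<open>\<theta>\<close>, before passing to cohomology. It is defined on the tensor product in all
  degrees, by taking components of degrees \<open>i\<^sub>0\<close> and \<open>j\<^sub>0\<close>.\<close>

lemma retraction_exists:
  obtains \<psi> where "abelian_group_hom U.tens C.tens \<psi>"
    "\<And>m n. \<lbrakk>m \<in> carrier M; n \<in> carrier N\<rbrakk> \<Longrightarrow> \<psi> (U.pure m n)
      = C.pure (cohom_class M i0 (homog_part M m i0)) (cohom_class N j0 (homog_part N n j0))"
proof (rule U.tensor_universal[OF C.T.abelian_group_axioms,
      of "\<lambda>m n. C.pure (cohom_class M i0 (homog_part M m i0)) (cohom_class N j0 (homog_part N n j0))"])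
  fix m n assume m: "m \<in> carrier M" and n: "n \<in> carrier N"
  note clM = HM.class_closed[unfolded cocycles_M, OF rm.M.homog_part_gr]
  note clN = HN.class_closed[unfolded cocycles_N, OF lm.N.homog_part_gr]
  show "C.pure (cohom_class M i0 (homog_part M m i0)) (cohom_class N j0 (homog_part N n j0)) \<in> carrier C.tens"
    using m n by (simp add: clM clN)
  show "C.pure (cohom_class M i0 (homog_part M (m \<oplus>\<^bsub>M\<^esub> m') i0)) (cohom_class N j0 (homog_part N n j0))
      = C.pure (cohom_class M i0 (homog_part M m i0)) (cohom_class N j0 (homog_part N n j0))
        \<oplus>\<^bsub>C.tens\<^esub> C.pure (cohom_class M i0 (homog_part M m' i0)) (cohom_class N j0 (homog_part N n j0))"
    if "m' \<in> carrier M" for m'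
    using m n that by (simp add: rm.M.homog_part_add HM.class_add[unfolded cocycles_M]
        rm.M.homog_part_gr C.pure_add_left clM clN)
  show "C.pure (cohom_class M i0 (homog_part M m i0)) (cohom_class N j0 (homog_part N (n \<oplus>\<^bsub>N\<^esub> n') j0))
      = C.pure (cohom_class M i0 (homog_part M m i0)) (cohom_class N j0 (homog_part N n j0))
        \<oplus>\<^bsub>C.tens\<^esub> C.pure (cohom_class M i0 (homog_part M m i0)) (cohom_class N j0 (homog_part N n' j0))"
    if "n' \<in> carrier N" for n'
    using m n that by (simp add: lm.N.homog_part_add HN.class_add[unfolded cocycles_N]
        lm.N.homog_part_gr C.pure_add_right clM clN)
  show "C.pure (cohom_class M i0 (homog_part M (ract M m a) i0)) (cohom_class N j0 (homog_part N n j0))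
      = C.pure (cohom_class M i0 (homog_part M m i0)) (cohom_class N j0 (homog_part N (lact N a n) j0))"
    if a: "a \<in> carrier A" for a
    using m n a HA.class_closed[unfolded cocycles_A, OF R.A.homog_part_gr[OF a]]
    by (simp add: homog_part_ract homog_part_lact rm.M.homog_part_gr lm.N.homog_part_gr
        R.A.homog_part_gr C.pure_balanced clM clN flip: ract_class lact_class)
qed (erule that; blast)

lemma retraction_coboundary:
  assumes \<psi>: "abelian_group_hom U.tens C.tens \<psi>"
    "\<And>m n. \<lbrakk>m \<in> carrier M; n \<in> carrier N\<rbrakk> \<Longrightarrow> \<psi> (U.pure m n)
      = C.pure (cohom_class M i0 (homog_part M m i0)) (cohom_class N j0 (homog_part N n j0))"
    and "t \<in> coboundaries T tdeg"
  shows "\<psi> t = \<zero>\<^bsub>C.tens\<^esub>"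
proof -
  interpret \<psi>: abelian_group_hom U.tens C.tens \<psi> by fact
  interpret d: abelian_group_hom U.tens U.tens "diff T" by (rule diff_T_hom)
  have dM: "cohom_class M i0 (homog_part M (diff M m) i0) = \<zero>\<^bsub>cohom M i0\<^esub>" if "m \<in> gr M i" for m i
    using that HM.class_zero HM.class_coboundary[of "diff M m"]
    by (auto simp: rm.M.homog_part_homog[OF rm.M.diff_degree[OF that]] coboundaries_def)
  have dN: "cohom_class N j0 (homog_part N (diff N n) j0) = \<zero>\<^bsub>cohom N j0\<^esub>" if "n \<in> gr N j" for n j
    using that HN.class_zero HN.class_coboundary[of "diff N n"]
    by (auto simp: lm.N.homog_part_homog[OF lm.N.diff_degree[OF that]] coboundaries_def)
  obtain u where "u \<in> gr T (tdeg - 1)" "t = diff T u" using assms(3) by (auto simp: coboundaries_def)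
  moreover have "\<psi> (diff T u) = \<zero>\<^bsub>C.tens\<^esub>" if "u \<in> gr T k" for u k
    using that
  proof (induction u rule: gr_T_induct)
    case zero
    then show ?case using d.hom_zero \<psi>.hom_zero by simp
  next
    case (pure m n i j)
    note car = rm.M.gr_closed[OF pure(1)] lm.N.gr_closed[OF pure(2)]
    have "\<psi> (U.pure (diff M m) n) = \<zero>\<^bsub>C.tens\<^esub>"
      using car \<psi>(2) dM[OF pure(1)] HN.class_closed[unfolded cocycles_N, OF lm.N.homog_part_gr]
      by (simp add: rm.M.diff_closed)
    moreover have "\<psi> (U.pure (sgn_twist M m) (diff N n)) = \<zero>\<^bsub>C.tens\<^esub>"
      using car \<psi>(2) dN[OF pure(2)] HM.class_closed[unfolded cocycles_M, OF rm.M.homog_part_gr]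
      by (simp add: lm.N.diff_closed rm.M.sgn_twist_closed)
    ultimately show ?case
      using car by (simp add: diff_T_pure diff_pair_def rm.M.diff_closed lm.N.diff_closed
          rm.M.sgn_twist_closed)
  next
    case (add s t)
    then show ?case using gr_T_closed by simp
  qed
  ultimately show ?thesis by blast
qed

lemma theta_bij:
  assumes \<theta>: "abelian_group_hom C.tens (cohom T tdeg) \<theta>"
    and on_pure: "\<And>m n. \<lbrakk>m \<in> gr M i0; n \<in> gr N j0\<rbrakk>
      \<Longrightarrow> \<theta> (C.pure (cohom_class M i0 m) (cohom_class N j0 n)) = cohom_class T tdeg (U.pure m n)"
  shows "bij_betw \<theta> (carrier C.tens) (carrier (cohom T tdeg))"
proof -
  interpret \<theta>: abelian_group_hom C.tens "cohom T tdeg" \<theta> by fact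
  obtain \<psi> where \<psi>: "abelian_group_hom U.tens C.tens \<psi>"
    and \<psi>_pure: "\<And>m n. \<lbrakk>m \<in> carrier M; n \<in> carrier N\<rbrakk> \<Longrightarrow> \<psi> (U.pure m n)
      = C.pure (cohom_class M i0 (homog_part M m i0)) (cohom_class N j0 (homog_part N n j0))"
    by (rule retraction_exists) blast
  interpret \<psi>: abelian_group_hom U.tens C.tens \<psi> by fact
  have \<psi>_coboundary: "\<psi> t = \<zero>\<^bsub>C.tens\<^esub>" if "t \<in> coboundaries T tdeg" for t
    by (rule retraction_coboundary[OF \<psi> _ that]) (rule \<psi>_pure)
  have T_closed: "t \<in> carrier U.tens" if "t \<in> X" "X \<in> carrier (cohom T tdeg)" for t X
    using that HT.class_repr(1) gr_T_closed by (auto simp: class_reprs cocycles_T)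
  \<comment> \<open>Representatives of \<open>\<theta> x\<close> are sums of representatives along the construction of \<open>x\<close>.\<close>
  have retract: "\<psi> t = x" if "x \<in> carrier C.tens" "t \<in> \<theta> x" for x t
    using that
  proof (induction x arbitrary: t rule: C.tensor_induct)
    case zero
    then have "t \<in> coboundaries T tdeg" using HT.zero_cohom \<theta>.hom_zero by simp
    then show ?case by (rule \<psi>_coboundary)
  next
    case (pure X Y)
    then obtain m n where mn: "m \<in> gr M i0" "X = cohom_class M i0 m"
      "n \<in> gr N j0" "Y = cohom_class N j0 n" by (auto simp: class_reprs)
    then have "t \<in> cohom_class T tdeg (U.pure m n)" using pure by (simp add: on_pure)
    then obtain b where b: "b \<in> coboundaries T tdeg" "t = b \<oplus>\<^bsub>T\<^esub> U.pure m n" by (rule HT.class_memE)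
    have "b \<in> carrier U.tens"
      using b(1) HT.coboundaries_cocycles gr_T_closed by (auto simp: cocycles_T)
    then show ?case
      using b mn \<psi>_coboundary[OF b(1)] pure rm.M.gr_closed lm.N.gr_closed
      by (simp add: \<psi>_pure rm.M.homog_part_homog lm.N.homog_part_homog)
  next
    case (add x y)
    then have "t \<in> \<theta> x \<oplus>\<^bsub>cohom T tdeg\<^esub> \<theta> y" by simp
    then obtain r s where rs: "r \<in> \<theta> x" "s \<in> \<theta> y" "t = r \<oplus>\<^bsub>T\<^esub> s" by (rule HT.cohom_add_memE)
    then show ?case
      using add T_closed[OF rs(1)] T_closed[OF rs(2)] by simp
  qed
  have ne: "\<exists>t. t \<in> \<theta> x" if "x \<in> carrier C.tens" for x
    using \<theta>.hom_closed[OF that] HT.class_self by (auto simp: HT.carrier_cohom)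
  have inj: "inj_on \<theta> (carrier C.tens)"
    using ne retract by (intro inj_onI) metis
  have surj: "cohom_class T tdeg t \<in> \<theta> ` carrier C.tens" if "t \<in> gr T tdeg" for t
    using that
  proof (induction t rule: gr_T_induct)
    case zero
    have "cohom_class T tdeg \<zero>\<^bsub>U.tens\<^esub> = \<theta> \<zero>\<^bsub>C.tens\<^esub>" using HT.class_zero \<theta>.hom_zero by simp
    then show ?case by (rule image_eqI) simp
  next
    case (pure m n i j)
    show ?case
    proof (cases "i = i0 \<and> j = j0")
      case True
      with pure have "cohom_class T tdeg (U.pure m n)
          = \<theta> (C.pure (cohom_class M i0 m) (cohom_class N j0 n))"
        by (simp add: on_pure)
      then show ?thesis
        by (rule image_eqI) (use True pure in \<open>simp add: class_reprs\<close>)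
    next
      case False
      then have "i > i0 \<or> j > j0" using pure(3) by linarith
      then have "U.pure m n = \<zero>\<^bsub>U.tens\<^esub>"
        using pure gr_M_above gr_N_above rm.M.gr_closed lm.N.gr_closed by auto
      then have "cohom_class T tdeg (U.pure m n) = \<theta> \<zero>\<^bsub>C.tens\<^esub>"
        using HT.class_zero \<theta>.hom_zero by simp
      then show ?thesis by (rule image_eqI) simp
    qed
  next
    case (add s t)
    then obtain x y where xy: "x \<in> carrier C.tens" "cohom_class T tdeg s = \<theta> x"
      "y \<in> carrier C.tens" "cohom_class T tdeg t = \<theta> y" by blast
    then have "cohom_class T tdeg (s \<oplus>\<^bsub>U.tens\<^esub> t) = \<theta> (x \<oplus>\<^bsub>C.tens\<^esub> y)"
      using add by (simp add: class_T_add)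
    then show ?case by (rule image_eqI) (use xy in simp)
  qed
  show ?thesis
    unfolding bij_betw_def using inj surj \<theta>.hom_closed by (auto simp: class_reprs)
qed


text \<open>The action of the scalars on \<open>H\<^sup>i(M)\<close>, for \<open>i = i\<^sub>0\<close>, through their classes in \<open>H\<^sup>0(A)\<close>.\<close>

abbreviation "kact k X \<equiv> cohom_ract M i0 X (cohom_class A 0 (\<iota> k))"

lemma kact_class:
  "\<lbrakk>k \<in> carrier K; m \<in> gr M i0\<rbrakk> \<Longrightarrow> kact k (cohom_class M i0 m) = cohom_class M i0 (ract M m (\<iota> k))"
  by (simp add: ract_class R.struct_degree)

lemma class_M_add:
  "\<lbrakk>m \<in> gr M i0; m' \<in> gr M i0\<rbrakk> \<Longrightarrow> cohom_class M i0 m \<oplus>\<^bsub>cohom M i0\<^esub> cohom_class M i0 m'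
    = cohom_class M i0 (m \<oplus>\<^bsub>M\<^esub> m')"
  using HM.class_add by (simp add: cocycles_M)

lemma kact_axioms:
  "\<And>k X. \<lbrakk>k \<in> carrier K; X \<in> carrier (cohom M i0)\<rbrakk> \<Longrightarrow> kact k X \<in> carrier (cohom M i0)"
  "\<And>k X Y. \<lbrakk>k \<in> carrier K; X \<in> carrier (cohom M i0); Y \<in> carrier (cohom M i0)\<rbrakk>
    \<Longrightarrow> kact k (X \<oplus>\<^bsub>cohom M i0\<^esub> Y) = kact k X \<oplus>\<^bsub>cohom M i0\<^esub> kact k Y"
  "\<And>k X r. \<lbrakk>k \<in> carrier K; X \<in> carrier (cohom M i0); r \<in> carrier (cohom A 0)\<rbrakk>
    \<Longrightarrow> kact k (cohom_ract M i0 X r) = cohom_ract M i0 (kact k X) r"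
  "\<And>k l X. \<lbrakk>k \<in> carrier K; l \<in> carrier K; X \<in> carrier (cohom M i0)\<rbrakk>
    \<Longrightarrow> kact (k \<oplus>\<^bsub>K\<^esub> l) X = kact k X \<oplus>\<^bsub>cohom M i0\<^esub> kact l X"
  "\<And>k l X. \<lbrakk>k \<in> carrier K; l \<in> carrier K; X \<in> carrier (cohom M i0)\<rbrakk>
    \<Longrightarrow> kact (k \<otimes>\<^bsub>K\<^esub> l) X = kact k (kact l X)"
  "\<And>X. X \<in> carrier (cohom M i0) \<Longrightarrow> kact \<one>\<^bsub>K\<^esub> X = X"
proof -
  show "kact k (cohom_ract M i0 X r) = cohom_ract M i0 (kact k X) r"
    if kXr: "k \<in> carrier K" "X \<in> carrier (cohom M i0)" "r \<in> carrier (cohom A 0)" for k X r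
  proof -
    obtain m a where ma: "m \<in> gr M i0" "X = cohom_class M i0 m" "a \<in> gr A 0" "r = cohom_class A 0 a"
      using kXr by (auto simp: class_reprs)
    then show ?thesis
      using kXr(1) scalar_axioms(3)[OF kXr(1) rm.M.gr_closed[OF ma(1)] R.A.gr_closed[OF ma(3)]]
      by (simp add: ract_class kact_class ract_gr ract_iota_gr)
  qed
qed (auto simp: class_reprs kact_class class_M_add rm.M.add_gr ract_iota_gr rm.M.gr_closed
      scalar_axioms(2,4,5,6))

lemma module_cohom_tensor: "module K (cohom_tensor A \<iota> i0 j0 M N)"
  using C.tensor_module[where s = kact, OF R.K.is_cring kact_axioms] unfolding cohom_tensor_def .

lemma cohom_tensor_simps [simp]:
  "carrier (cohom_tensor A \<iota> i0 j0 M N) = carrier C.tens"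
  "add (cohom_tensor A \<iota> i0 j0 M N) = add C.tens"
  by (simp_all add: cohom_tensor_def ring.defs)

lemma smult_cohom_tensor_hom:
  "k \<in> carrier K \<Longrightarrow> abelian_group_hom C.tens C.tens (\<lambda>x. k \<odot>\<^bsub>cohom_tensor A \<iota> i0 j0 M N\<^esub> x)"
  using C.smult_tensor_hom(1)[where s = kact, OF R.K.is_cring kact_axioms]
  by (simp add: cohom_tensor_def ring.defs module.defs)

lemma smult_cohom_tensor_pure:
  "\<lbrakk>k \<in> carrier K; m \<in> gr M i0; n \<in> gr N j0\<rbrakk>
    \<Longrightarrow> k \<odot>\<^bsub>cohom_tensor A \<iota> i0 j0 M N\<^esub> C.pure (cohom_class M i0 m) (cohom_class N j0 n)
      = C.pure (cohom_class M i0 (ract M m (\<iota> k))) (cohom_class N j0 n)"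
  using C.smult_tensor_hom(2)[where s = kact, OF R.K.is_cring kact_axioms]
  by (simp add: cohom_tensor_def ring.defs module.defs class_reprs kact_class)

lemma cohom_kmodule_simps [simp]:
  "carrier (cohom_kmodule T tdeg) = carrier (cohom T tdeg)"
  "add (cohom_kmodule T tdeg) = add (cohom T tdeg)"
  "\<zero>\<^bsub>cohom_kmodule T tdeg\<^esub> = \<zero>\<^bsub>cohom T tdeg\<^esub>"
  "k \<odot>\<^bsub>cohom_kmodule T tdeg\<^esub> x = cohom_map T tdeg (lact T k) x"
  by (simp_all add: cohom_kmodule_def ring.defs module.defs)

lemma cohom_map_lact:
  assumes "k \<in> carrier K"
  shows "\<And>t. t \<in> gr T tdeg \<Longrightarrow>
      cohom_map T tdeg (lact T k) (cohom_class T tdeg t) = cohom_class T tdeg (lact T k t)"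
    and "abelian_group_hom (cohom T tdeg) (cohom T tdeg) (cohom_map T tdeg (lact T k))"
proof -
  have deg: "cohom_degree T tdeg" by (rule HT.cohom_degree_axioms)
  have hom: "abelian_group_hom T T (lact T k)"
    by (rule abelian_group_hom_transfer[OF lact_T_hom[OF assms] T.abelian_group_axioms
          T.abelian_group_axioms]) simp_all
  have cocycles: "lact T k t \<in> cocycles T tdeg" if "t \<in> cocycles T tdeg" for t
    using that lact_T_gr[OF assms] by (simp add: cocycles_T)
  have coboundaries: "lact T k t \<in> coboundaries T tdeg" if "t \<in> coboundaries T tdeg" for t
    using that lact_T_gr[OF assms] lact_T_diff[OF assms] unfolding coboundaries_def
    by (auto simp flip: lact_T_diff[OF assms])
  note * = cohom_map_class[OF deg deg hom cocycles coboundaries]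
  show "cohom_map T tdeg (lact T k) (cohom_class T tdeg t) = cohom_class T tdeg (lact T k t)"
    if "t \<in> gr T tdeg" for t
    by (rule *(1)) (use that in \<open>auto simp: cocycles_T\<close>)
  show "abelian_group_hom (cohom T tdeg) (cohom T tdeg) (cohom_map T tdeg (lact T k))"
    by (rule *(2))
qed

lemma module_cohom_T: "module K (cohom_kmodule T tdeg)"
proof (rule moduleI, unfold cohom_kmodule_simps)
  have T: "carrier (ring.extend U.tens (module.fields (lact T))) = carrier U.tens"
    "add (ring.extend U.tens (module.fields (lact T))) = add U.tens"
    "k \<odot>\<^bsub>ring.extend U.tens (module.fields (lact T))\<^esub> t = lact T k t" for k t
    by (simp_all add: ring.defs module.defs)
  note laws = module.smult_l_distr[OF lact_T_module] module.smult_assoc1[OF lact_T_module]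
    module.smult_one[OF lact_T_module]
  note laws = laws[unfolded T]
  show "abelian_group (cohom_kmodule T tdeg)"
    by (rule abelian_group_transfer[OF HT.H.abelian_group_axioms]) simp_all
  fix k X assume k: "k \<in> carrier K" and X: "X \<in> carrier (cohom T tdeg)"
  then obtain t where t: "t \<in> gr T tdeg" "X = cohom_class T tdeg t" by (auto simp: class_reprs)
  note tc = gr_T_closed[OF t(1)]
  show "cohom_map T tdeg (lact T k) X \<in> carrier (cohom T tdeg)"
    using abelian_group_hom.hom_closed[OF cohom_map_lact(2)[OF k]] X .
  show "cohom_map T tdeg (lact T k) (X \<oplus>\<^bsub>cohom T tdeg\<^esub> Y)
      = cohom_map T tdeg (lact T k) X \<oplus>\<^bsub>cohom T tdeg\<^esub> cohom_map T tdeg (lact T k) Y"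
    if "Y \<in> carrier (cohom T tdeg)" for Y
    using abelian_group_hom.hom_add[OF cohom_map_lact(2)[OF k]] X that .
  fix l assume l: "l \<in> carrier K"
  show "cohom_map T tdeg (lact T (k \<oplus>\<^bsub>K\<^esub> l)) X
      = cohom_map T tdeg (lact T k) X \<oplus>\<^bsub>cohom T tdeg\<^esub> cohom_map T tdeg (lact T l) X"
    using k l t tc by (simp add: cohom_map_lact laws class_T_add lact_T_gr)
  show "cohom_map T tdeg (lact T (k \<otimes>\<^bsub>K\<^esub> l)) X
      = cohom_map T tdeg (lact T k) (cohom_map T tdeg (lact T l) X)"
    using k l t tc by (simp add: cohom_map_lact laws lact_T_gr)
next
  fix X assume "X \<in> carrier (cohom T tdeg)"
  then obtain t where t: "t \<in> gr T tdeg" "X = cohom_class T tdeg t" by (auto simp: class_reprs)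
  have "lact T \<one>\<^bsub>K\<^esub> t = t"
    using module.smult_one[OF lact_T_module, of t] gr_T_closed[OF t(1)]
    by (simp add: ring.defs module.defs)
  then show "cohom_map T tdeg (lact T \<one>\<^bsub>K\<^esub>) X = X"
    using t by (simp add: cohom_map_lact)
qed (rule R.K.is_cring)

lemma is_theta_hom:
  assumes "is_theta K A \<iota> i0 j0 M N \<theta>"
  shows "abelian_group_hom C.tens (cohom T tdeg) \<theta>"
    and "\<And>m n. \<lbrakk>m \<in> gr M i0; n \<in> gr N j0\<rbrakk>
      \<Longrightarrow> \<theta> (C.pure (cohom_class M i0 m) (cohom_class N j0 n)) = cohom_class T tdeg (U.pure m n)"
proof -
  show "abelian_group_hom C.tens (cohom T tdeg) \<theta>"
    using assms unfolding is_theta_def kmodule_iso_def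
    by (intro abelian_group_hom_intro C.T.abelian_group_axioms HT.H.abelian_group_axioms)
      (auto dest: bij_betwE)
  show "\<theta> (C.pure (cohom_class M i0 m) (cohom_class N j0 n)) = cohom_class T tdeg (U.pure m n)"
    if "m \<in> gr M i0" "n \<in> gr N j0" for m n
    using assms that unfolding is_theta_def cohom_pure_def by simp
qed

lemma cohom_pure_hom_eq:
  assumes "abelian_group_hom C.tens L f" "abelian_group_hom C.tens L g"
    and "\<And>m n. \<lbrakk>m \<in> gr M i0; n \<in> gr N j0\<rbrakk> \<Longrightarrow>
      f (C.pure (cohom_class M i0 m) (cohom_class N j0 n)) = g (C.pure (cohom_class M i0 m) (cohom_class N j0 n))"
    and "x \<in> carrier C.tens"
  shows "f x = g x"
  by (rule C.tensor_hom_eq[OF assms(1,2) _ assms(4)]) (auto simp: class_reprs assms(3))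

lemma ex1_theta: "\<exists>!\<theta>. is_theta K A \<iota> i0 j0 M N \<theta>"
proof (rule ex_ex1I)
  obtain \<theta> where hom: "abelian_group_hom C.tens (cohom T tdeg) \<theta>"
    and on_pure: "\<And>m n. \<lbrakk>m \<in> gr M i0; n \<in> gr N j0\<rbrakk>
      \<Longrightarrow> \<theta> (C.pure (cohom_class M i0 m) (cohom_class N j0 n)) = cohom_class T tdeg (U.pure m n)"
    by (rule theta_hom_exists) blast
  interpret \<theta>: abelian_group_hom C.tens "cohom T tdeg" \<theta> by (rule hom)
  have bij: "bij_betw \<theta> (carrier C.tens) (carrier (cohom T tdeg))"
    by (rule theta_bij[OF hom on_pure])
  have pure_closed: "C.pure (cohom_class M i0 m) (cohom_class N j0 n) \<in> carrier C.tens"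
    if "m \<in> gr M i0" "n \<in> gr N j0" for m n
    using that by (simp add: class_reprs)
  have smult_closed: "k \<odot>\<^bsub>cohom_tensor A \<iota> i0 j0 M N\<^esub> x \<in> carrier C.tens"
    if "k \<in> carrier K" "x \<in> carrier C.tens" for k x
    using abelian_group_hom.hom_closed[OF smult_cohom_tensor_hom[OF that(1)] that(2)] .
  have smult: "\<theta> (k \<odot>\<^bsub>cohom_tensor A \<iota> i0 j0 M N\<^esub> x) = cohom_map T tdeg (lact T k) (\<theta> x)"
    if k: "k \<in> carrier K" and x: "x \<in> carrier C.tens" for k x
  proof (rule cohom_pure_hom_eq[OF abelian_group_hom_comp[OF smult_cohom_tensor_hom[OF k] hom]
        abelian_group_hom_comp[OF hom cohom_map_lact(2)[OF k]] _ x])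
    fix m n assume mn: "m \<in> gr M i0" "n \<in> gr N j0"
    then show "\<theta> (k \<odot>\<^bsub>cohom_tensor A \<iota> i0 j0 M N\<^esub> C.pure (cohom_class M i0 m) (cohom_class N j0 n))
      = cohom_map T tdeg (lact T k) (\<theta> (C.pure (cohom_class M i0 m) (cohom_class N j0 n)))"
      using k rm.M.gr_closed lm.N.gr_closed
      by (simp add: smult_cohom_tensor_pure on_pure ract_iota_gr cohom_map_lact pure_gr_T lact_T_pure)
  qed
  have "bij_betw (restrict \<theta> (carrier C.tens)) (carrier C.tens) (carrier (cohom T tdeg))"
    using bij by (simp cong: bij_betw_cong)
  then have "is_theta K A \<iota> i0 j0 M N (restrict \<theta> (carrier C.tens))"
    using module_cohom_tensor module_cohom_T
    by (simp add: is_theta_def kmodule_iso_def cohom_pure_def on_pure pure_closed smult smult_closed)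
  then show "\<exists>\<theta>. is_theta K A \<iota> i0 j0 M N \<theta>" by blast
next
  fix \<theta> \<theta>' assume th: "is_theta K A \<iota> i0 j0 M N \<theta>" and th': "is_theta K A \<iota> i0 j0 M N \<theta>'"
  have "\<theta> \<in> extensional (carrier C.tens)" "\<theta>' \<in> extensional (carrier C.tens)"
    using th th' by (simp_all add: is_theta_def)
  moreover have "\<theta> x = \<theta>' x" if "x \<in> carrier C.tens" for x
    by (rule cohom_pure_hom_eq[OF is_theta_hom(1)[OF th] is_theta_hom(1)[OF th'] _ that])
      (simp add: is_theta_hom(2)[OF th] is_theta_hom(2)[OF th'])
  ultimately show "\<theta> = \<theta>'" by (rule extensionalityI)
qed

end


section \<open>Functoriality\<close>

lemma strict_group_hom_facts:
  assumes "dg_group M" "dg_group M'" "strict_group_hom M M' f"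
  shows "abelian_group_hom M M' f"
    and "\<And>x i. x \<in> gr M i \<Longrightarrow> f x \<in> gr M' i"
    and "\<And>x. x \<in> carrier M \<Longrightarrow> f (diff M x) = diff M' (f x)"
    and "\<And>x. x \<in> carrier M \<Longrightarrow> f (sgn_twist M x) = sgn_twist M' (f x)"
    and "\<And>x i. x \<in> cocycles M i \<Longrightarrow> f x \<in> cocycles M' i"
    and "\<And>x i. x \<in> coboundaries M i \<Longrightarrow> f x \<in> coboundaries M' i"
proof -
  interpret M: dg_group M by fact
  interpret M': dg_group M' by fact
  show hom: "abelian_group_hom M M' f"
    using assms(3) unfolding strict_group_hom_def
    by (intro abelian_group_hom_intro M.abelian_group_axioms M'.abelian_group_axioms) auto
  then interpret f: abelian_group_hom M M' f .
  show gr: "f x \<in> gr M' i" if "x \<in> gr M i" for x i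
    using assms(3) that unfolding strict_group_hom_def by blast
  show diff: "f (diff M x) = diff M' (f x)" if "x \<in> carrier M" for x
    using assms(3) that unfolding strict_group_hom_def by blast
  show "f (sgn_twist M x) = sgn_twist M' (f x)" if "x \<in> carrier M" for x
    using that
  proof (induction x rule: M.homog_induct)
    case (homog i x)
    then show ?case
      by (simp add: M.sgn_twist_homog M'.sgn_twist_homog[OF gr[OF homog]] M.gr_closed f.hom_sgn_mult)
  next
    case (add x y)
    then show ?case by (simp add: M.sgn_twist_add M'.sgn_twist_add M.sgn_twist_closed)
  qed
  show "f x \<in> cocycles M' i" if "x \<in> cocycles M i" for x i
    using that gr diff[of x] M.gr_closed[of x i] f.hom_zero by (auto simp: cocycles_def)
  show "f x \<in> coboundaries M' i" if "x \<in> coboundaries M i" for x i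
    using that gr diff M.gr_closed unfolding coboundaries_def by blast
qed

lemma theta_natural:
  fixes M :: "('a, 'm) right_dg" and N :: "('a, 'n) left_dg"
    and M' :: "('a, 'p) right_dg" and N' :: "('a, 'q) left_dg"
  assumes "dg_pair_top K A \<iota> M N i0 j0" and "dg_pair_top K A \<iota> M' N' i0 j0"
    and f: "strict_right_hom A M M' f" and g: "strict_left_hom A N N' g"
    and th: "is_theta K A \<iota> i0 j0 M N \<theta>" and th': "is_theta K A \<iota> i0 j0 M' N' \<theta>'"
    and x: "x \<in> carrier (cohom_tensor A \<iota> i0 j0 M N)"
  shows "\<theta>' (cohom_tensor_map A i0 j0 M' N' f g x) =
    cohom_map (dg_tensor A \<iota> M' N') (i0 + j0) (dg_tensor_map A M' N' f g) (\<theta> x)"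
proof -
  interpret D: dg_pair_top K A \<iota> M N i0 j0 by fact
  interpret D': dg_pair_top K A \<iota> M' N' i0 j0 by fact
  have f_act: "f (ract M m a) = ract M' (f m) a" if "m \<in> carrier M" "a \<in> carrier A" for m a
    using f that by (simp add: strict_right_hom_def)
  have g_act: "g (lact N a n) = lact N' a (g n)" if "n \<in> carrier N" "a \<in> carrier A" for n a
    using g that by (simp add: strict_left_hom_def)
  note fs = strict_group_hom_facts[OF D.rm.M.dg_group_axioms D'.rm.M.dg_group_axioms
      conjunct1[OF f[unfolded strict_right_hom_def]]]
  note gs = strict_group_hom_facts[OF D.lm.N.dg_group_axioms D'.lm.N.dg_group_axioms
      conjunct1[OF g[unfolded strict_left_hom_def]]]
  interpret f: abelian_group_hom M M' f by (rule fs(1))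
  interpret g: abelian_group_hom N N' g by (rule gs(1))
  let ?F = "dg_tensor_map A M' N' f g" and ?G = "cohom_tensor_map A i0 j0 M' N' f g"

  have F: "abelian_group_hom D.U.tens D'.U.tens ?F"
    and F_pure: "\<And>m n. \<lbrakk>m \<in> carrier M; n \<in> carrier N\<rbrakk>
      \<Longrightarrow> ?F (D.U.pure m n) = D'.U.pure (f m) (g n)"
  proof -
    have bal: "D'.U.pure (f (ract M m a)) (g n) = D'.U.pure (f m) (g (lact N a n))"
      if "m \<in> carrier M" "a \<in> carrier A" "n \<in> carrier N" for m a n
      using that by (simp add: f_act g_act D'.U.pure_balanced)
    note * = tensor_map_hom[OF D.U.balanced_pair_axioms D'.U.balanced_pair_axioms fs(1) gs(1) bal,
        folded dg_tensor_map_def]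
    show "abelian_group_hom D.U.tens D'.U.tens ?F" by (rule *(1))
    show "?F (D.U.pure m n) = D'.U.pure (f m) (g n)" if "m \<in> carrier M" "n \<in> carrier N" for m n
      by (rule *(2)) (use that in auto)
  qed
  interpret F: abelian_group_hom D.U.tens D'.U.tens ?F by (rule F)
  have F_diff: "?F (diff D.T t) = diff D'.T (?F t)" if "t \<in> carrier D.U.tens" for t
  proof (rule D.U.tensor_hom_eq[OF abelian_group_hom_comp[OF D.diff_T_hom F]
        abelian_group_hom_comp[OF F D'.diff_T_hom] _ that])
    fix m n assume "m \<in> carrier M" "n \<in> carrier N"
    then show "?F (diff D.T (D.U.pure m n)) = diff D'.T (?F (D.U.pure m n))"
      by (simp add: D.diff_T_pure D'.diff_T_pure D.diff_pair_def D'.diff_pair_def F_pure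
          D.rm.M.diff_closed D.lm.N.diff_closed D.rm.M.sgn_twist_closed fs(3,4) gs(3))
  qed
  have F_gr: "?F t \<in> gr D'.T k" if "t \<in> gr D.T k" for t k
    using that
  proof (induction t rule: D.gr_T_induct)
    case zero
    then show ?case
      using additive_subgroup.zero_closed[OF D'.gr_T_subgroup] F.hom_zero by simp
  next
    case (pure m n i j)
    then show ?case
      using D'.pure_gr_T[OF fs(2)[OF pure(1)] gs(2)[OF pure(2)] pure(3)]
      by (simp add: F_pure D.rm.M.gr_closed D.lm.N.gr_closed)
  next
    case (add s t)
    then show ?case
      using additive_subgroup.a_closed[OF D'.gr_T_subgroup] by (simp add: D.gr_T_closed)
  qed
  have HF: "abelian_group_hom (cohom D.T D.tdeg) (cohom D'.T D.tdeg) (cohom_map D'.T D.tdeg ?F)"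
    and HF_class: "\<And>t. t \<in> gr D.T D.tdeg
      \<Longrightarrow> cohom_map D'.T D.tdeg ?F (cohom_class D.T D.tdeg t) = cohom_class D'.T D.tdeg (?F t)"
  proof -
    have T_hom: "abelian_group_hom D.T D'.T ?F"
      by (rule abelian_group_hom_transfer[OF F D.T.abelian_group_axioms D'.T.abelian_group_axioms])
        simp_all
    have cocycles: "?F t \<in> cocycles D'.T D.tdeg" if "t \<in> cocycles D.T D.tdeg" for t
      using that F_gr by (simp add: D.cocycles_T D'.cocycles_T)
    have coboundaries: "?F t \<in> coboundaries D'.T D.tdeg" if "t \<in> coboundaries D.T D.tdeg" for t
      using that F_gr F_diff D.gr_T_closed unfolding coboundaries_def by blast
    note * = cohom_map_class[OF D.HT.cohom_degree_axioms D'.HT.cohom_degree_axioms T_hom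
        cocycles coboundaries]
    show "abelian_group_hom (cohom D.T D.tdeg) (cohom D'.T D.tdeg) (cohom_map D'.T D.tdeg ?F)"
      by (rule *(2))
    show "cohom_map D'.T D.tdeg ?F (cohom_class D.T D.tdeg t) = cohom_class D'.T D.tdeg (?F t)"
      if "t \<in> gr D.T D.tdeg" for t
      by (rule *(1)) (use that in \<open>auto simp: D.cocycles_T\<close>)
  qed

  note Hf = cohom_map_class[OF D.HM.cohom_degree_axioms D'.HM.cohom_degree_axioms fs(1,5,6),
      unfolded D.cocycles_M]
  note Hg = cohom_map_class[OF D.HN.cohom_degree_axioms D'.HN.cohom_degree_axioms gs(1,5,6),
      unfolded D.cocycles_N]
  have G: "abelian_group_hom D.C.tens D'.C.tens ?G"
    and G_pure: "\<And>m n. \<lbrakk>m \<in> gr M i0; n \<in> gr N j0\<rbrakk>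
      \<Longrightarrow> ?G (D.C.pure (cohom_class M i0 m) (cohom_class N j0 n))
        = D'.C.pure (cohom_class M' i0 (f m)) (cohom_class N' j0 (g n))"
  proof -
    have bal: "D'.C.pure (cohom_map M' i0 f (cohom_ract M i0 X r)) (cohom_map N' j0 g Y)
        = D'.C.pure (cohom_map M' i0 f X) (cohom_map N' j0 g (cohom_lact N j0 r Y))"
      if XrY: "X \<in> carrier (cohom M i0)" "r \<in> carrier (cohom A 0)" "Y \<in> carrier (cohom N j0)" for X r Y
    proof -
      obtain m a n where mn: "m \<in> gr M i0" "X = cohom_class M i0 m" "a \<in> gr A 0"
        "r = cohom_class A 0 a" "n \<in> gr N j0" "Y = cohom_class N j0 n"
        using XrY by (auto simp: D.class_reprs)
      have "D'.C.pure (cohom_ract M' i0 (cohom_class M' i0 (f m)) r) (cohom_class N' j0 (g n))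
          = D'.C.pure (cohom_class M' i0 (f m)) (cohom_lact N' j0 r (cohom_class N' j0 (g n)))"
        by (rule D'.C.pure_balanced) (use mn fs(2) gs(2) in \<open>auto simp: D'.class_reprs\<close>)
      then show ?thesis
        using mn D.rm.M.gr_closed D.lm.N.gr_closed D.R.A.gr_closed
        by (simp add: D.ract_class D.lact_class D'.ract_class D'.lact_class Hf(1) Hg(1)
            D.ract_gr D.lact_gr fs(2) gs(2) f_act g_act)
    qed
    note * = tensor_map_hom[OF D.C.balanced_pair_axioms D'.C.balanced_pair_axioms Hf(2) Hg(2) bal,
        folded cohom_tensor_map_def]
    show "abelian_group_hom D.C.tens D'.C.tens ?G"
      by (rule *(1))
    show "?G (D.C.pure (cohom_class M i0 m) (cohom_class N j0 n))
        = D'.C.pure (cohom_class M' i0 (f m)) (cohom_class N' j0 (g n))"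
      if mn: "m \<in> gr M i0" "n \<in> gr N j0" for m n
    proof -
      have "?G (D.C.pure (cohom_class M i0 m) (cohom_class N j0 n))
          = D'.C.pure (cohom_map M' i0 f (cohom_class M i0 m)) (cohom_map N' j0 g (cohom_class N j0 n))"
        by (rule *(2)) (use mn in \<open>auto simp: D.class_reprs\<close>)
      then show ?thesis using mn by (simp add: Hf(1) Hg(1))
    qed
  qed

  show ?thesis
  proof (rule D.cohom_pure_hom_eq[OF abelian_group_hom_comp[OF G D'.is_theta_hom(1)[OF th']]
        abelian_group_hom_comp[OF D.is_theta_hom(1)[OF th] HF]])
    fix m n assume mn: "m \<in> gr M i0" "n \<in> gr N j0"
    then show "\<theta>' (?G (D.C.pure (cohom_class M i0 m) (cohom_class N j0 n)))
      = cohom_map D'.T D.tdeg ?F (\<theta> (D.C.pure (cohom_class M i0 m) (cohom_class N j0 n)))"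
      using D.rm.M.gr_closed D.lm.N.gr_closed
      by (simp add: G_pure D'.is_theta_hom(2)[OF th'] D.is_theta_hom(2)[OF th] fs(2) gs(2)
          HF_class D.pure_gr_T F_pure)
  qed (use x in simp)
qed

theorem theorem1:
  fixes K :: "'k ring" and A :: "'a dg" and \<iota> :: "'k \<Rightarrow> 'a"
    and i0 j0 :: int
    and M :: "('a, 'm) right_dg" and N :: "('a, 'n) left_dg"
  assumes "central_dg_ring K A \<iota>" and "nonpositive A"
    and "right_dg_module A M" and "concentrated_le M i0"
    and "left_dg_module A N" and "concentrated_le N j0"
  shows "(\<exists>!\<theta>. is_theta K A \<iota> i0 j0 M N \<theta>) \<and>
    (\<forall>(M' :: ('a, 'm') right_dg) (N' :: ('a, 'n') left_dg) f g \<theta> \<theta>'.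
       right_dg_module A M' \<and> concentrated_le M' i0 \<and>
       left_dg_module A N' \<and> concentrated_le N' j0 \<and>
       strict_right_hom A M M' f \<and> strict_left_hom A N N' g \<and>
       is_theta K A \<iota> i0 j0 M N \<theta> \<and> is_theta K A \<iota> i0 j0 M' N' \<theta>' \<longrightarrow>
       (\<forall>x\<in>carrier (cohom_tensor A \<iota> i0 j0 M N).
          \<theta>' (cohom_tensor_map A i0 j0 M' N' f g x) =
          cohom_map (dg_tensor A \<iota> M' N') (i0 + j0) (dg_tensor_map A M' N' f g) (\<theta> x)))"
proof (intro conjI allI impI ballI)
  have pair: "dg_pair_top K A \<iota> M N i0 j0"
    using assms by (intro dg_pair_top.intro dg_pair.intro dg_pair_top_axioms.intro)
  then show "\<exists>!\<theta>. is_theta K A \<iota> i0 j0 M N \<theta>" by (rule dg_pair_top.ex1_theta)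
  fix M' :: "('a, 'm') right_dg" and N' :: "('a, 'n') left_dg" and f g \<theta> \<theta>' x
  assume *: "right_dg_module A M' \<and> concentrated_le M' i0 \<and>
       left_dg_module A N' \<and> concentrated_le N' j0 \<and>
       strict_right_hom A M M' f \<and> strict_left_hom A N N' g \<and>
       is_theta K A \<iota> i0 j0 M N \<theta> \<and> is_theta K A \<iota> i0 j0 M' N' \<theta>'"
    and x: "x \<in> carrier (cohom_tensor A \<iota> i0 j0 M N)"
  have pair': "dg_pair_top K A \<iota> M' N' i0 j0"
    using assms(1,2) * by (intro dg_pair_top.intro dg_pair.intro dg_pair_top_axioms.intro) blast+
  show "\<theta>' (cohom_tensor_map A i0 j0 M' N' f g x) =
      cohom_map (dg_tensor A \<iota> M' N') (i0 + j0) (dg_tensor_map A M' N' f g) (\<theta> x)"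
    using * by (intro theta_natural[OF pair pair' _ _ _ _ x]) blast+
qed

end
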